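(* Let $\phi : M^2\to\mathbb{R}^4\equiv\mathbb{C}^2$ be a compact self-shrinker, i.e. an isometric immersion of a compact surface with $H=-\phi^\perp$. If $\phi$ is a Hamiltonian stationary Lagrangian embedding, then $M$ is the Clifford torus $\mathbb{S}^1\times\mathbb{S}^1$ (the product of two unit circles centered at the origin in $\mathbb{C}\times\mathbb{C}$).
   Context: $H=\operatorname{trace}\sigma$ is the (unnormalized) mean curvature vector, $\sigma$ the second fundamental form, $\phi^\perp$ the normal projection of the position vector. $\phi$ is Lagrangian if the Kähler form $\omega(\cdot,\cdot)=\langle J\cdot,\cdot\rangle$ of $\mathbb{C}^2$ ($J$ the standard complex structure) vanishes on $M$; then $JH$ is a tangent vector field on $M$, and a Lagrangian immersion is Hamiltonian stationary if $\operatorname{div}(JH)=0$ on $M$. The identification with the Clifford torus is up to a linear isometry of $\mathbb{R}^4$. *)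

theory Defs
  imports "HOL-Analysis.Analysis"
begin

type_synonym C2 = "complex \<times> complex"
type_synonym R2 = "real \<times> real"

definition cJ :: "C2 \<Rightarrow> C2" where
  "cJ v = (\<i> * fst v, \<i> * snd v)"

definition kahler :: "C2 \<Rightarrow> C2 \<Rightarrow> real" where
  "kahler u v = inner (cJ u) v"

definition dir :: "bool \<Rightarrow> R2" where
  "dir b = (if b then (1, 0) else (0, 1))"

definition pd :: "bool \<Rightarrow> (R2 \<Rightarrow> 'a::real_normed_vector) \<Rightarrow> R2 \<Rightarrow> 'a" where
  "pd b g p = vector_derivative (\<lambda>t. g (p + t *\<^sub>R dir b)) (at 0)"

fun iterpd :: "bool list \<Rightarrow> (R2 \<Rightarrow> 'a::real_normed_vector) \<Rightarrow> R2 \<Rightarrow> 'a" where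
  "iterpd [] g = g"
| "iterpd (b # bs) g = pd b (iterpd bs g)"

definition smooth_on :: "R2 set \<Rightarrow> (R2 \<Rightarrow> 'a::real_normed_vector) \<Rightarrow> bool" where
  "smooth_on U g \<longleftrightarrow> open U \<and>
     (\<forall>bs. continuous_on U (iterpd bs g) \<and>
        (\<forall>b. \<forall>p\<in>U. (\<lambda>t. iterpd bs g (p + t *\<^sub>R dir b)) differentiable (at 0)))"

definition chart :: "C2 set \<Rightarrow> R2 set \<Rightarrow> (R2 \<Rightarrow> C2) \<Rightarrow> bool" where
  "chart S U f \<longleftrightarrow> U \<noteq> {} \<and> smooth_on U f \<and> f ` U \<subseteq> S \<and>
     openin (top_of_set S) (f ` U) \<and>
     (\<exists>g. homeomorphism U (f ` U) f g) \<and>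
     (\<forall>u\<in>U. pd True f u \<noteq> pd False f u \<and> independent {pd True f u, pd False f u})"

definition embedded_surface :: "C2 set \<Rightarrow> bool" where
  "embedded_surface S \<longleftrightarrow> (\<forall>x\<in>S. \<exists>U f. chart S U f \<and> x \<in> f ` U)"

definition gmet :: "(R2 \<Rightarrow> C2) \<Rightarrow> R2 \<Rightarrow> bool \<Rightarrow> bool \<Rightarrow> real" where
  "gmet f u i j = inner (pd i f u) (pd j f u)"

definition ginv :: "(R2 \<Rightarrow> C2) \<Rightarrow> R2 \<Rightarrow> bool \<Rightarrow> bool \<Rightarrow> real" where
  "ginv f u i j =
     (let d = gmet f u True True * gmet f u False False - (gmet f u True False)^2 in
      if i = j then gmet f u (\<not> i) (\<not> i) / d else - gmet f u True False / d)"

definition tanproj :: "(R2 \<Rightarrow> C2) \<Rightarrow> R2 \<Rightarrow> C2 \<Rightarrow> C2" where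
  "tanproj f u v = (\<Sum>i\<in>UNIV. \<Sum>j\<in>UNIV. (ginv f u i j * inner v (pd j f u)) *\<^sub>R pd i f u)"

definition nproj :: "(R2 \<Rightarrow> C2) \<Rightarrow> R2 \<Rightarrow> C2 \<Rightarrow> C2" where
  "nproj f u v = v - tanproj f u v"

text \<open>Unnormalized mean curvature vector H = trace of the second fundamental form.\<close>
definition meancurv :: "(R2 \<Rightarrow> C2) \<Rightarrow> R2 \<Rightarrow> C2" where
  "meancurv f u = (\<Sum>i\<in>UNIV. \<Sum>j\<in>UNIV. ginv f u i j *\<^sub>R nproj f u (pd i (pd j f) u))"

text \<open>Divergence on the surface of an (R^4-valued, tangent) vector field X given in the
  chart: div X = g^ij <d_i X, f_j>.\<close>
definition surf_div :: "(R2 \<Rightarrow> C2) \<Rightarrow> (R2 \<Rightarrow> C2) \<Rightarrow> R2 \<Rightarrow> real" where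
  "surf_div f X u = (\<Sum>i\<in>UNIV. \<Sum>j\<in>UNIV. ginv f u i j * inner (pd i X u) (pd j f u))"

definition self_shrinker :: "C2 set \<Rightarrow> bool" where
  "self_shrinker S \<longleftrightarrow> (\<forall>U f. chart S U f \<longrightarrow>
     (\<forall>u\<in>U. meancurv f u = - nproj f u (f u)))"

definition lagrangian :: "C2 set \<Rightarrow> bool" where
  "lagrangian S \<longleftrightarrow> (\<forall>U f. chart S U f \<longrightarrow>
     (\<forall>u\<in>U. kahler (pd True f u) (pd False f u) = 0))"

definition hamiltonian_stationary :: "C2 set \<Rightarrow> bool" where
  "hamiltonian_stationary S \<longleftrightarrow> (\<forall>U f. chart S U f \<longrightarrow>
     (\<forall>u\<in>U. surf_div f (\<lambda>v. cJ (meancurv f v)) u = 0))"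

definition clifford_torus :: "C2 set" where
  "clifford_torus = {(z, w). cmod z = 1 \<and> cmod w = 1}"

end

theory Submission
  imports Defs
begin

text \<open>
Write \<open>x = x\<^sup>T + JX\<close> on the surface, where \<open>X = JH\<close>, and put \<open>a = |X|\<close>, \<open>r = |x|\<close>.
Since \<open>div X = \<langle>X, x\<^sup>T\<rangle>\<close> for a Lagrangian self-shrinker, Hamiltonian stationarity says \<open>X \<bottom> x\<^sup>T\<close>.
Differentiating this orthogonality determines the second fundamental form and shows that
\<open>(1 - a\<^sup>2) / (a\<^sup>2 r\<^sup>2)\<close> is locally constant where \<open>X \<noteq> 0\<close>. Looking at a point of maximal \<open>r\<close>,
compactness and connectedness give \<open>a\<^sup>2 (k - r\<^sup>2) = k\<close> on all of \<open>S\<close> for some \<open>k > 0\<close>.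
The fields \<open>W = X / a\<^sup>2\<close> and \<open>V\<close> (tangent, orthogonal to \<open>X\<close>, with \<open>|V|\<^sup>2 = k - r\<^sup>2\<close>, defined up to
sign) then satisfy the linear equations \<open>D\<^sub>W W = x / k - JW\<close> and \<open>D\<^sub>V V = -x\<close>. Hence their orbits
are explicit and stay in \<open>S\<close>, so \<open>S\<close> contains all
\<open>cos s exp(-i\<alpha>t) x\<^sub>0 + sin s exp(-i\<beta>t) v\<^sub>0\<close> with \<open>\<alpha> + \<beta> = 1\<close>, \<open>|x\<^sub>0|\<^sup>2 = 1/\<alpha>\<close>, \<open>|v\<^sub>0|\<^sup>2 = 1/\<beta>\<close>.
As \<open>S\<close> is embedded, the sheets through \<open>x\<^sub>0\<close> and \<open>v\<^sub>0\<close> have a single tangent plane there, which forces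
both \<open>\<alpha>/\<beta>\<close> and \<open>\<beta>/\<alpha>\<close> to be integers. So \<open>\<alpha> = \<beta>\<close>, and \<open>S\<close> contains, hence equals, a Clifford torus.
\<close>

section \<open>One-sided tangent vectors and invariance under flows\<close>

text \<open>The orbits are written down in the ambient space as solutions of linear equations, and
  an invariance principle shows that such a solution never leaves a compact set to which the
  equation is tangent. Two obstacles decide how it is applied. \<open>W\<close> is not linear in the
  position, so its equation is read as a linear first order system for the pair (position,
  \<open>W\<close>) on the graph of \<open>W\<close>. \<open>V\<close> has a sign that can be chosen
  only locally, so the pairs (position, vector) with both signs are taken together as one compact
  set. These sets lie in a product space and come without charts; this is why tangency is expressed
  by \<open>tang\<close>, through curves that are differentiable from the right at a single time. On
  a surface with charts it gives back the usual tangent plane. The invariance principle runs forward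
  in time, so membership in \<open>S\<close> is first obtained for nonnegative parameters and
  extended at the end by periodicity.\<close>

definition tang :: "'a::real_normed_vector set \<Rightarrow> 'a \<Rightarrow> 'a set" where
  "tang S x = {v. \<exists>\<gamma>. \<gamma> 0 = x \<and> (\<forall>t\<ge>0. \<gamma> t \<in> S) \<and>
     (\<gamma> has_vector_derivative v) (at 0 within {0..})}"

text \<open>The derivative looks only at times near 0, so a curve that stays in \<open>S\<close>
  briefly may jump back to \<open>x\<close> afterwards.\<close>

lemma tangI_eventually:
  assumes "\<gamma> 0 = x" "d > 0" "\<And>t. 0 \<le> t \<Longrightarrow> t < d \<Longrightarrow> \<gamma> t \<in> S"
    "(\<gamma> has_vector_derivative v) (at 0 within {0..})"
  shows "v \<in> tang S x"
proof -
  define \<delta> where "\<delta> t = (if t < d then \<gamma> t else x)" for t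
  have "(\<delta> has_vector_derivative v) (at 0 within {0..})"
    by (rule has_vector_derivative_transform_within[OF assms(4,2)])
       (auto simp: \<delta>_def dist_real_def)
  moreover have "\<forall>t\<ge>0. \<delta> t \<in> S"
    using assms(1,2) assms(3) assms(3)[of 0] by (auto simp: \<delta>_def)
  moreover have "\<delta> 0 = x" using assms(1,2) by (simp add: \<delta>_def)
  ultimately show ?thesis unfolding tang_def by blast
qed

lemma tang_compose:
  assumes "(g has_derivative D) (at x within S)" "\<gamma> 0 = x" "\<forall>t\<ge>0. \<gamma> t \<in> S"
    "(\<gamma> has_vector_derivative v) (at 0 within {0..})"
  shows "((\<lambda>t. g (\<gamma> t)) has_vector_derivative D v) (at 0 within {0..})"
proof -
  have "(g has_derivative D) (at (\<gamma> 0) within \<gamma> ` {0..})"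
    using assms(1-3) by (auto intro: has_derivative_subset)
  from diff_chain_within[OF assms(4)[unfolded has_vector_derivative_def] this]
  show ?thesis
    using has_derivative_bounded_linear[OF assms(1)]
    by (simp add: has_vector_derivative_def o_def linear_cmul bounded_linear.linear)
qed

lemma one_sided_vector_derivative_unique:
  assumes "(f has_vector_derivative u) (at (0::real) within {0..})"
    "(f has_vector_derivative v) (at 0 within {0..})"
  shows "u = v"
proof -
  have "at (0::real) within {0..} = at_right 0"
    by (metis at_within_Icc_at_right at_within_Ici_at_right)
  then have "at (0::real) within {0..} \<noteq> bot" by simp
  from vector_derivative_unique_within[OF this assms] show ?thesis .
qed

text \<open>The device by which relations valid on \<open>S\<close> are differentiated. A derivative
  within \<open>S\<close> is determined only along tangent vectors, hence the test on
  \<open>tang S x\<close>.\<close>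

lemma tang_derivative_const:
  assumes "(g has_derivative D) (at x within S)" "\<And>y. y \<in> S \<Longrightarrow> g y = c" "v \<in> tang S x"
  shows "D v = 0"
proof -
  obtain \<gamma> where g: "\<gamma> 0 = x" "\<forall>t\<ge>0. \<gamma> t \<in> S"
    "(\<gamma> has_vector_derivative v) (at 0 within {0..})"
    using assms(3) by (auto simp: tang_def)
  have "((\<lambda>t. g (\<gamma> t)) has_vector_derivative D v) (at 0 within {0..})"
    by (rule tang_compose[OF assms(1) g])
  moreover have "((\<lambda>t. g (\<gamma> t)) has_vector_derivative 0) (at 0 within {0..})"
    by (rule has_vector_derivative_transform_within[of "\<lambda>_. c" _ _ _ 1])
       (use assms(2) g in auto)
  ultimately show ?thesis by (rule one_sided_vector_derivative_unique)
qed

text \<open>Monotonicity from one-sided difference quotients; the distance to a set, to which this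
  is applied, need not be differentiable.\<close>

lemma dini_nonincreasing:
  fixes D :: "real \<Rightarrow> real"
  assumes cont: "continuous_on {0..} D"
    and dini: "\<And>t e. t \<ge> 0 \<Longrightarrow> e > 0 \<Longrightarrow>
      \<exists>d>0. \<forall>h. 0 < h \<and> h < d \<longrightarrow> D (t + h) \<le> D t + e * h"
    and "t \<ge> 0"
  shows "D t \<le> D 0"
proof -
  have "D t \<le> D 0 + e * t" if e: "e > 0" for e
  proof (rule ccontr)
    assume neg: "\<not> ?thesis"
    \<comment> \<open>If the largest element of this set were below \<open>t\<close>, the one-sided
      bound at it would produce a larger one.\<close>
    define A where "A = {s \<in> {0..t}. D s - e * s \<le> D 0}"
    have "continuous_on {0..t} (\<lambda>s. D s - e * s)"
      by (intro continuous_intros continuous_on_subset[OF cont]) auto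
    then have "closed A"
      unfolding A_def by (intro continuous_closed_preimage_constant
          continuous_on_closed_Collect_le continuous_closed_preimage) (auto intro: continuous_closed_preimage)
    then have "compact A"
      by (metis (no_types, lifting) A_def bounded_closed_interval bounded_subset compact_eq_bounded_closed mem_Collect_eq subsetI)
    moreover have "0 \<in> A" using assms(3) by (auto simp: A_def)
    ultimately obtain s where s: "s \<in> A" "\<And>r. r \<in> A \<Longrightarrow> r \<le> s"
      using compact_attains_sup[of A] by blast
    have "s < t" using s neg unfolding A_def by (cases "s = t") (auto simp: algebra_simps)
    obtain d where d: "d > 0" "\<And>h. 0 < h \<Longrightarrow> h < d \<Longrightarrow> D (s + h) \<le> D s + e * h"
      using dini[of s e] s e by (auto simp: A_def)
    define h where "h = min (d/2) (t - s)"
    have h: "0 < h" "h < d" "s + h \<le> t" using d \<open>s < t\<close> by (auto simp: h_def)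
    have "s + h \<in> A" using d(2)[OF h(1,2)] s h by (auto simp: A_def algebra_simps)
    with s(2)[of "s+h"] h show False by simp
  qed
  then have "\<forall>e>0. D t \<le> D 0 + e"
    by (smt (verit, ccfv_SIG) assms(3) divide_pos_pos mult_nonneg_nonneg nonzero_mult_div_cancel_right times_divide_eq_left)
  then show ?thesis by (meson field_le_epsilon)
qed

text \<open>Nagumo's invariance principle: the distance to \<open>S\<close> of an integral curve satisfies a
  one-sided Gronwall inequality, since the nearest point of \<open>S\<close> may be moved along \<open>S\<close>.\<close>

lemma tangent_linear_flow_invariant:
  fixes S :: "'a::euclidean_space set"
  assumes "compact S" and Y: "bounded_linear Y"
    and tan: "\<And>y. y \<in> S \<Longrightarrow> Y y \<in> tang S y"
    and z: "\<And>t. (z has_vector_derivative Y (z t)) (at t)" and "z 0 \<in> S" and "t \<ge> 0"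
  shows "z t \<in> S"
proof -
  obtain L where L: "L > 0" "\<And>x. norm (Y x) \<le> norm x * L"
    using bounded_linear.pos_bounded[OF Y] by blast
  define D where "D t = infdist (z t) S" for t
  have S: "closed S" "S \<noteq> {}" using assms compact_imp_closed by auto
  have contz: "continuous_on A z" for A
    using z by (meson continuous_at_imp_continuous_on has_vector_derivative_continuous)
  have key: "\<exists>d>0. \<forall>h. 0 < h \<and> h < d \<longrightarrow> D (t + h) \<le> D t * (1 + L * h) + e * h"
    if "e > 0" for t e
  proof -
    obtain y where y: "y \<in> S" "D t = dist (z t) y"
      unfolding D_def using infdist_attains_inf[OF S] by metis
    obtain \<gamma> where g: "\<gamma> 0 = y" "\<forall>t\<ge>0. \<gamma> t \<in> S"
      "(\<gamma> has_vector_derivative Y y) (at 0 within {0..})"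
      using tan[OF y(1)] by (auto simp: tang_def)
    have "\<exists>d>0. \<forall>s\<in>{0..}. norm (s - 0) < d \<longrightarrow>
        norm (\<gamma> s - \<gamma> 0 - (s - 0) *\<^sub>R Y y) \<le> e/2 * norm (s - 0)"
      using g(3) \<open>e > 0\<close> unfolding has_vector_derivative_def has_derivative_within_alt
      by (meson half_gt_zero)
    then obtain d1 where d1: "d1 > 0"
      "\<And>s. 0 \<le> s \<Longrightarrow> s < d1 \<Longrightarrow> norm (\<gamma> s - y - s *\<^sub>R Y y) \<le> e/2 * s"
      using g(1) by auto
    have "\<exists>d>0. \<forall>s\<in>UNIV. norm (s - t) < d \<longrightarrow>
        norm (z s - z t - (s - t) *\<^sub>R Y (z t)) \<le> e/2 * norm (s - t)"
      using z[of t] \<open>e > 0\<close> unfolding has_vector_derivative_def has_derivative_within_alt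
      by (meson half_gt_zero)
    then obtain d2 where d2: "d2 > 0"
      "\<And>s. norm (s - t) < d2 \<Longrightarrow> norm (z s - z t - (s - t) *\<^sub>R Y (z t)) \<le> e/2 * norm (s - t)"
      by auto
    have "D (t + h) \<le> D t * (1 + L * h) + e * h" if h: "0 < h" "h < min d1 d2" for h
    proof -
      have "D (t + h) \<le> dist (z (t + h)) (\<gamma> h)"
        unfolding D_def using g h by (intro infdist_le) auto
      \<comment> \<open>Both curves are replaced by their first order expansions; what remains is
        the gap \<open>z t - y\<close> carried along by the linear field.\<close>
      also have "\<dots> = norm ((z (t + h) - z t - h *\<^sub>R Y (z t)) - (\<gamma> h - y - h *\<^sub>R Y y)
           + ((z t - y) + h *\<^sub>R Y (z t - y)))"
        by (simp add: dist_norm linear_diff[OF bounded_linear.linear[OF Y]] algebra_simps)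
      also have "\<dots> \<le> (e/2 * h + e/2 * h) + (norm (z t - y) + h * (norm (z t - y) * L))"
      proof -
        have "norm (z (t + h) - z t - h *\<^sub>R Y (z t)) \<le> e/2 * h"
          using d2(2)[of "t + h"] h by auto
        moreover have "norm (\<gamma> h - y - h *\<^sub>R Y y) \<le> e/2 * h" using d1(2)[of h] h by auto
        moreover have "norm (h *\<^sub>R Y (z t - y)) \<le> h * (norm (z t - y) * L)"
          using L h by (auto intro!: mult_left_mono)
        ultimately show ?thesis
          by (meson add_mono norm_triangle_le norm_triangle_le_diff order_refl)
      qed
      finally show ?thesis by (simp add: y dist_norm algebra_simps)
    qed
    then show ?thesis using d1 d2 by (intro exI[of _ "min d1 d2"]) auto
  qed
  \<comment> \<open>The weight absorbs the growth factor \<open>1 + L * h\<close> in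
    \<open>key\<close>, which leaves the hypothesis of the monotonicity criterion.\<close>
  define G where "G t = exp (- L * t) * D t" for t
  have D0: "D t \<ge> 0" for t by (simp add: D_def infdist_nonneg)
  have "G t \<le> G 0"
  proof (rule dini_nonincreasing)
    show "continuous_on {0..} G"
      unfolding G_def D_def by (intro continuous_intros contz)
    fix t e :: real assume te: "t \<ge> 0" "e > 0"
    obtain d where d: "d > 0" "\<And>h. 0 < h \<Longrightarrow> h < d \<Longrightarrow> D (t + h) \<le> D t * (1 + L * h) + e * h"
      using key[OF te(2)] by blast
    have "G (t + h) \<le> G t + e * h" if h: "0 < h" "h < d" for h
    proof -
      have "1 + L * h \<le> exp (L * h)" by simp
      then have "D (t + h) \<le> D t * exp (L * h) + e * h"
        using d(2)[OF h] mult_left_mono[OF _ D0[of t]] by (smt (verit))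
      then have "G (t + h) \<le> exp (- L * (t + h)) * (D t * exp (L * h) + e * h)"
        unfolding G_def by (intro mult_left_mono) auto
      also have "\<dots> = G t + exp (- L * (t + h)) * (e * h)"
        by (simp add: G_def algebra_simps exp_add[symmetric] flip: mult.assoc)
      also have "\<dots> \<le> G t + 1 * (e * h)"
        using te h L by (intro add_left_mono mult_right_mono) auto
      finally show ?thesis by simp
    qed
    then show "\<exists>d>0. \<forall>h. 0 < h \<and> h < d \<longrightarrow> G (t + h) \<le> G t + e * h" using d by blast
  qed fact
  then have "D t = 0" using \<open>z 0 \<in> S\<close> D0[of t] by (simp add: G_def D_def mult_le_0_iff)
  then show ?thesis using in_closed_iff_infdist_zero[OF S] by (auto simp: D_def)
qed

section \<open>Partial derivatives\<close>

lemma line_derivative: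
  assumes "\<And>q. q \<in> U \<Longrightarrow> (\<lambda>t. g (q + t *\<^sub>R dir b)) differentiable (at 0)"
    "q + t *\<^sub>R dir b \<in> U"
  shows "((\<lambda>t. g (q + t *\<^sub>R dir b)) has_vector_derivative pd b g (q + t *\<^sub>R dir b)) (at t)"
proof -
  have "((\<lambda>s. g ((q + t *\<^sub>R dir b) + s *\<^sub>R dir b)) has_vector_derivative pd b g (q + t *\<^sub>R dir b)) (at 0)"
    using assms unfolding pd_def by (metis vector_derivative_works)
  then have "((\<lambda>s. g ((q + t *\<^sub>R dir b) + s *\<^sub>R dir b)) \<circ> (\<lambda>s. s - t) has_vector_derivative
       1 *\<^sub>R pd b g (q + t *\<^sub>R dir b)) (at t)"
    by (intro vector_diff_chain_at) (auto intro!: derivative_eq_intros)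
  then show ?thesis
    by (simp add: o_def scaleR_diff_left)
qed

text \<open>\<open>smooth_on\<close> speaks of derivatives along coordinate lines; continuity of a
  partial derivative upgrades them to a Frechet derivative.\<close>

lemma has_derivative_from_partials:
  fixes g :: "R2 \<Rightarrow> 'a::real_normed_vector"
  assumes "open U" "p \<in> U" and cont: "continuous_on U (pd False g)"
    and d: "\<And>b q. q \<in> U \<Longrightarrow> (\<lambda>t. g (q + t *\<^sub>R dir b)) differentiable (at 0)"
  shows "(g has_derivative (\<lambda>h. fst h *\<^sub>R pd True g p + snd h *\<^sub>R pd False g p)) (at p)"
proof -
  obtain x y where p: "p = (x, y)" by (cases p)
  obtain e where e: "e > 0" "ball p e \<subseteq> U" using assms(1,2) openE by blast
  define A where "A = ball x (e/2)"
  define Y where "Y = ball y (e/2)"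
  have "q \<in> U" if "q \<in> A \<times> Y" for q
  proof -
    have "dist p q \<le> dist x (fst q) + dist y (snd q)"
      unfolding p by (cases q) (simp add: dist_Pair_Pair sqrt_sum_squares_le_sum)
    then show ?thesis using that e by (auto simp: A_def Y_def)
  qed
  then have Y: "open A" "x \<in> A" "open Y" "y \<in> Y" "convex Y" "A \<times> Y \<subseteq> U"
    using e by (auto simp: A_def Y_def)
  have 1: "((\<lambda>x. g (x, y)) has_vector_derivative pd True g p) (at x)"
    using line_derivative[of U g True "(0, y)" x, OF d] assms(2) by (simp add: dir_def p)
  have 2: "((\<lambda>y. g (x, y)) has_vector_derivative pd False g (x, y)) (at y)" if "(x, y) \<in> U" for x y
    using line_derivative[of U g False "(x, 0)" y, OF d] that by (simp add: dir_def)
  have "((\<lambda>(x, y). g (x, y)) has_derivative (\<lambda>(tx, ty). tx *\<^sub>R pd True g p +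
     blinfun_apply (blinfun_scaleR_left (pd False g (x, y))) ty)) (at (x, y) within A \<times> Y)"
  proof (rule has_derivative_partialsI)
    show "((\<lambda>x. g (x, y)) has_derivative (\<lambda>t. t *\<^sub>R pd True g p)) (at x within A)"
      using 1 unfolding has_vector_derivative_def by (rule has_derivative_at_withinI)
    show "((\<lambda>y. g (x, y)) has_derivative blinfun_apply (blinfun_scaleR_left (pd False g (x, y))))
        (at y within Y)" if "x \<in> A" "y \<in> Y" for x y
    proof -
      have "(x, y) \<in> U" using that Y by auto
      from has_derivative_at_withinI[OF 2[OF this, unfolded has_vector_derivative_def]]
      show ?thesis by simp
    qed
    have "isCont (pd False g) (x, y)"
      using cont assms(2) p by (simp add: continuous_on_eq_continuous_at[OF assms(1)])
    then have "continuous (at (x, y) within A \<times> Y) (\<lambda>q. blinfun_scaleR_left (pd False g q))"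
      by (rule bounded_linear.continuous[OF bounded_linear_blinfun_scaleR_left
            continuous_at_imp_continuous_at_within])
    then show "continuous (at (x, y) within A \<times> Y) (\<lambda>(x, y). blinfun_scaleR_left (pd False g (x, y)))"
      by (simp add: case_prod_unfold)
  qed (rule Y)+
  moreover have "at (x, y) within A \<times> Y = at (x, y)"
    using Y by (intro at_within_open open_Times) simp_all
  ultimately show ?thesis by (simp add: p case_prod_unfold)
qed

text \<open>The mean value theorem, once in each variable. Pairing with \<open>z\<close> makes
  everything real, since the mean value equality fails for vector-valued functions.\<close>

lemma mixed_difference_mvt:
  fixes g :: "R2 \<Rightarrow> 'a::real_inner"
  assumes d: "\<And>q. q \<in> U \<Longrightarrow> (\<lambda>t. g (q + t *\<^sub>R dir b)) differentiable (at 0)"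
    "\<And>q. q \<in> U \<Longrightarrow> (\<lambda>t. pd b g (q + t *\<^sub>R dir c)) differentiable (at 0)"
    and h: "h > 0" "\<And>s t. 0 \<le> s \<Longrightarrow> s \<le> h \<Longrightarrow> 0 \<le> t \<Longrightarrow> t \<le> h \<Longrightarrow> p + s *\<^sub>R dir b + t *\<^sub>R dir c \<in> U"
  shows "\<exists>s t. 0 \<le> s \<and> s \<le> h \<and> 0 \<le> t \<and> t \<le> h \<and>
    inner z (g (p + h *\<^sub>R dir b + h *\<^sub>R dir c) - g (p + h *\<^sub>R dir b) - g (p + h *\<^sub>R dir c) + g p)
     = h * h * inner z (pd c (pd b g) (p + s *\<^sub>R dir b + t *\<^sub>R dir c))"
proof -
  define F where "F s = inner z (g (p + s *\<^sub>R dir b + h *\<^sub>R dir c)) - inner z (g (p + s *\<^sub>R dir b))" for s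
  define F' where "F' s = inner z (pd b g (p + s *\<^sub>R dir b + h *\<^sub>R dir c))
      - inner z (pd b g (p + s *\<^sub>R dir b))" for s
  have F: "DERIV F s :> F' s" if "0 \<le> s" "s \<le> h" for s
  proof -
    have "((\<lambda>t. g ((p + h *\<^sub>R dir c) + t *\<^sub>R dir b)) has_vector_derivative
        pd b g ((p + h *\<^sub>R dir c) + s *\<^sub>R dir b)) (at s)"
      by (rule line_derivative[of U]) (use d h(1) h(2)[of s h] that in \<open>auto simp: algebra_simps\<close>)
    note 1 = bounded_linear.has_vector_derivative[OF bounded_linear_inner_right[of z] this]
    have "((\<lambda>t. g (p + t *\<^sub>R dir b)) has_vector_derivative pd b g (p + s *\<^sub>R dir b)) (at s)"
      by (rule line_derivative[of U]) (use d h(1) h(2)[of s 0] that in auto)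
    note 2 = bounded_linear.has_vector_derivative[OF bounded_linear_inner_right[of z] this]
    have "(F has_vector_derivative F' s) (at s)"
      using has_vector_derivative_diff[OF 1 2] unfolding F_def F'_def by (simp add: add_ac)
    then show ?thesis by (simp add: has_real_derivative_iff_has_vector_derivative)
  qed
  obtain s where s: "0 < s" "s < h" "F h - F 0 = (h - 0) * F' s"
    using MVT2[OF h(1), of F F'] F by blast
  define G where "G t = inner z (pd b g (p + s *\<^sub>R dir b + t *\<^sub>R dir c))" for t
  have G: "DERIV G t :> inner z (pd c (pd b g) (p + s *\<^sub>R dir b + t *\<^sub>R dir c))" if "0 \<le> t" "t \<le> h" for t
  proof -
    have "((\<lambda>t. pd b g (p + s *\<^sub>R dir b + t *\<^sub>R dir c)) has_vector_derivative
        pd c (pd b g) (p + s *\<^sub>R dir b + t *\<^sub>R dir c)) (at t)"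
      by (rule line_derivative[of U]) (use d h(1) h(2)[of s t] that s in auto)
    from bounded_linear.has_vector_derivative[OF bounded_linear_inner_right[of z] this]
    show ?thesis unfolding G_def has_real_derivative_iff_has_vector_derivative .
  qed
  obtain t where t: "0 < t" "t < h"
    "G h - G 0 = (h - 0) * inner z (pd c (pd b g) (p + s *\<^sub>R dir b + t *\<^sub>R dir c))"
    using MVT2[OF h(1), of G "\<lambda>t. inner z (pd c (pd b g) (p + s *\<^sub>R dir b + t *\<^sub>R dir c))"] G by blast
  have "F' s = G h - G 0" by (simp add: F'_def G_def)
  then have "F h - F 0 = h * h * inner z (pd c (pd b g) (p + s *\<^sub>R dir b + t *\<^sub>R dir c))"
    using s(3) t(3) by simp
  moreover have "inner z (g (p + h *\<^sub>R dir b + h *\<^sub>R dir c) - g (p + h *\<^sub>R dir b)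
      - g (p + h *\<^sub>R dir c) + g p) = F h - F 0"
    by (simp add: F_def inner_diff_right inner_add_right)
  ultimately show ?thesis using s(1,2) t(1,2) by (metis less_imp_le)
qed

text \<open>Schwarz's theorem: the second difference over a small square is symmetric in the two
  directions, and divided by \<open>h * h\<close> it approximates either mixed partial.\<close>

lemma mixed_partials_commute:
  fixes g :: "R2 \<Rightarrow> 'a::real_inner"
  assumes "open U" "p \<in> U"
    and d: "\<And>b q. q \<in> U \<Longrightarrow> (\<lambda>t. g (q + t *\<^sub>R dir b)) differentiable (at 0)"
    "\<And>b c q. q \<in> U \<Longrightarrow> (\<lambda>t. pd b g (q + t *\<^sub>R dir c)) differentiable (at 0)"
    and cont: "\<And>b c. continuous_on U (pd b (pd c g))"
  shows "pd b (pd c g) p = pd c (pd b g) p"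
proof (rule ccontr)
  assume ne: "pd b (pd c g) p \<noteq> pd c (pd b g) p"
  \<comment> \<open>Paired with their own discrepancy, the two mixed partials differ by exactly
    \<open>2 * e\<close>, while both lie within \<open>e\<close> of the same difference
    quotient.\<close>
  define z where "z = pd b (pd c g) p - pd c (pd b g) p"
  define e where "e = inner z z / 2"
  have e: "e > 0" using ne by (simp add: e_def z_def)
  have "\<exists>d>0. \<forall>q. dist q p < d \<longrightarrow> q \<in> U \<and> \<bar>inner z (pd b (pd c g) q) - inner z (pd b (pd c g) p)\<bar> < e" for b c
  proof -
    have "isCont (\<lambda>q. inner z (pd b (pd c g) q)) p"
      using cont assms(2) by (intro continuous_intros) (simp add: continuous_on_eq_continuous_at[OF assms(1)])
    then obtain d where "d > 0"
      "\<forall>q. dist q p < d \<longrightarrow> \<bar>inner z (pd b (pd c g) q) - inner z (pd b (pd c g) p)\<bar> < e"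
      using e unfolding continuous_at_eps_delta dist_real_def by blast
    moreover obtain d' where "d' > 0" "\<forall>q. dist q p < d' \<longrightarrow> q \<in> U"
      using assms(1,2) unfolding open_dist by blast
    ultimately show ?thesis by (intro exI[of _ "min d d'"]) auto
  qed
  note near = this
  obtain d1 where d1: "d1 > 0" "\<And>q. dist q p < d1 \<Longrightarrow> q \<in> U"
     "\<And>q. dist q p < d1 \<Longrightarrow> \<bar>inner z (pd b (pd c g) q) - inner z (pd b (pd c g) p)\<bar> < e"
    using near[of b c] by blast
  obtain d2 where d2: "d2 > 0"
     "\<And>q. dist q p < d2 \<Longrightarrow> \<bar>inner z (pd c (pd b g) q) - inner z (pd c (pd b g) p)\<bar> < e"
    using near[of c b] by blast
  define h where "h = min d1 d2 / 4"
  have h: "h > 0" using d1 d2 by (simp add: h_def)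
  have nd: "norm (dir b) = 1" for b by (simp add: dir_def norm_Pair)
  have close: "dist (p + s *\<^sub>R dir b + t *\<^sub>R dir c) p < min d1 d2"
    if "0 \<le> s" "s \<le> h" "0 \<le> t" "t \<le> h" for s t b c
  proof -
    have "dist (p + s *\<^sub>R dir b + t *\<^sub>R dir c) p = norm (s *\<^sub>R dir b + t *\<^sub>R dir c)"
      by (simp add: dist_norm algebra_simps)
    also have "\<dots> \<le> s + t" using norm_triangle_ineq[of "s *\<^sub>R dir b" "t *\<^sub>R dir c"] that nd by simp
    also have "\<dots> < min d1 d2" using that h by (simp add: h_def)
    finally show ?thesis .
  qed
  have inU: "p + s *\<^sub>R dir b + t *\<^sub>R dir c \<in> U"
    if "0 \<le> s" "s \<le> h" "0 \<le> t" "t \<le> h" for s t b c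
    using d1(2) close[OF that] by simp
  obtain s t where st: "0 \<le> s" "s \<le> h" "0 \<le> t" "t \<le> h"
    "inner z (g (p + h *\<^sub>R dir b + h *\<^sub>R dir c) - g (p + h *\<^sub>R dir b) - g (p + h *\<^sub>R dir c) + g p)
     = h * h * inner z (pd c (pd b g) (p + s *\<^sub>R dir b + t *\<^sub>R dir c))"
    using mixed_difference_mvt[of U g b c h p z, OF d h inU] by auto
  obtain s' t' where st': "0 \<le> s'" "s' \<le> h" "0 \<le> t'" "t' \<le> h"
    "inner z (g (p + h *\<^sub>R dir c + h *\<^sub>R dir b) - g (p + h *\<^sub>R dir c) - g (p + h *\<^sub>R dir b) + g p)
     = h * h * inner z (pd b (pd c g) (p + s' *\<^sub>R dir c + t' *\<^sub>R dir b))"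
    using mixed_difference_mvt[of U g c b h p z, OF d h inU] by auto
  have "inner z (pd c (pd b g) (p + s *\<^sub>R dir b + t *\<^sub>R dir c))
     = inner z (pd b (pd c g) (p + s' *\<^sub>R dir c + t' *\<^sub>R dir b))"
  proof -
    have "h * h * inner z (pd c (pd b g) (p + s *\<^sub>R dir b + t *\<^sub>R dir c))
     = h * h * inner z (pd b (pd c g) (p + s' *\<^sub>R dir c + t' *\<^sub>R dir b))"
      using st(5) st'(5) by (simp add: algebra_simps)
    then show ?thesis using h by simp
  qed
  moreover have "\<bar>inner z (pd c (pd b g) (p + s *\<^sub>R dir b + t *\<^sub>R dir c)) - inner z (pd c (pd b g) p)\<bar> < e"
    using close[OF st(1-4)] by (intro d2(2)) auto
  moreover have "\<bar>inner z (pd b (pd c g) (p + s' *\<^sub>R dir c + t' *\<^sub>R dir b)) - inner z (pd b (pd c g) p)\<bar> < e"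
    using close[OF st'(1-4)] by (intro d1(3)) auto
  ultimately have "\<bar>inner z (pd b (pd c g) p) - inner z (pd c (pd b g) p)\<bar> < 2 * e" by linarith
  moreover have "inner z (pd b (pd c g) p) - inner z (pd c (pd b g) p) = 2 * e"
    by (simp add: e_def z_def inner_diff_right)
  ultimately show False using e by simp
qed

lemma smooth_on_iterpd_has_derivative:
  assumes "smooth_on U f" "u \<in> U"
  shows "(iterpd bs f has_derivative (\<lambda>h. fst h *\<^sub>R iterpd (True # bs) f u + snd h *\<^sub>R iterpd (False # bs) f u)) (at u)"
proof -
  have s: "open U" "\<And>bs. continuous_on U (iterpd bs f)"
    "\<And>bs b p. p \<in> U \<Longrightarrow> (\<lambda>t. iterpd bs f (p + t *\<^sub>R dir b)) differentiable (at 0)"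
    using assms(1) by (simp_all add: smooth_on_def)
  show ?thesis
    using has_derivative_from_partials[OF s(1) assms(2), of "iterpd bs f", OF _ s(3)]
      s(2)[of "False # bs"] by simp
qed

lemma smooth_on_mixed_partials:
  fixes f :: "R2 \<Rightarrow> 'a::real_inner"
  assumes "smooth_on U f" "u \<in> U"
  shows "pd b (pd c f) u = pd c (pd b f) u"
proof -
  have s: "open U" "\<And>bs. continuous_on U (iterpd bs f)"
    "\<And>bs b p. p \<in> U \<Longrightarrow> (\<lambda>t. iterpd bs f (p + t *\<^sub>R dir b)) differentiable (at 0)"
    using assms(1) by (simp_all add: smooth_on_def)
  show ?thesis
  proof (rule mixed_partials_commute[OF s(1) assms(2)])
    fix b c q assume "q \<in> U"
    show "(\<lambda>t. f (q + t *\<^sub>R dir b)) differentiable at 0"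
      using s(3)[OF \<open>q \<in> U\<close>, of "[]"] by simp
    show "(\<lambda>t. pd b f (q + t *\<^sub>R dir c)) differentiable at 0"
      using s(3)[OF \<open>q \<in> U\<close>, of "[b]"] by simp
  next
    fix b c
    show "continuous_on U (pd b (pd c f))" using s(2)[of "[b,c]"] by simp
  qed
qed

section \<open>Charts of embedded surfaces\<close>

definition chdiff :: "(R2 \<Rightarrow> C2) \<Rightarrow> R2 \<Rightarrow> R2 \<Rightarrow> C2" where
  "chdiff f u h = fst h *\<^sub>R pd True f u + snd h *\<^sub>R pd False f u"

lemma linear_chdiff: "linear (chdiff f u)"
  by (rule linearI) (simp_all add: chdiff_def algebra_simps)

lemma chart_has_derivative:
  assumes "chart S U f" "u \<in> U"
  shows "(f has_derivative chdiff f u) (at u)"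
    "(pd b f has_derivative chdiff (pd b f) u) (at u)"
  using smooth_on_iterpd_has_derivative[of U f u "[]"] smooth_on_iterpd_has_derivative[of U f u "[b]"] assms
  by (simp_all add: chart_def chdiff_def[abs_def])

lemma chart_mixed_partials:
  assumes "chart S U f" "u \<in> U"
  shows "pd b (pd c f) u = pd c (pd b f) u"
  using assms(1) by (intro smooth_on_mixed_partials[OF _ assms(2)]) (simp add: chart_def)

lemma inj_chdiff:
  assumes "chart S U f" "u \<in> U"
  shows "inj (chdiff f u)"
proof -
  have ne: "pd True f u \<noteq> pd False f u" and ind: "independent {pd True f u, pd False f u}"
    using assms by (auto simp: chart_def)
  have "a = 0 \<and> b = 0" if "a *\<^sub>R pd True f u + b *\<^sub>R pd False f u = 0" for a b
  proof (rule ccontr)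
    assume "\<not> (a = 0 \<and> b = 0)"
    have "dependent {pd True f u, pd False f u}"
      unfolding dependent_finite[OF finite.insertI[OF finite.insertI[OF finite.emptyI]]]
      using that ne \<open>\<not> (a = 0 \<and> b = 0)\<close>
      by (intro exI[of _ "\<lambda>v. if v = pd True f u then a else b"]) auto
    with ind show False by simp
  qed
  then have "h = 0" if "chdiff f u h = 0" for h
    using that by (cases h) (auto simp: chdiff_def zero_prod_def)
  then show ?thesis using linear_injective_0[OF linear_chdiff] by blast
qed

text \<open>The homeomorphism supplies only continuity of \<open>g\<close>. Injectivity of the
  differential gives a lower bound \<open>c0 * norm h\<close> for its values, and this turns the
  first order expansion of \<open>f\<close> into one of \<open>g\<close>, with a linear left inverse
  as derivative. As the image of the chart is open in \<open>S\<close>, limits within the image are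
  limits within \<open>S\<close>.\<close>

lemma chart_inverse:
  assumes c: "chart S U f" and u: "u \<in> U"
  obtains g P where "\<And>v. v \<in> U \<Longrightarrow> g (f v) = v" "(g has_derivative P) (at (f u) within S)"
    "\<And>h. P (chdiff f u h) = h"
proof -
  have U: "open U" using c by (simp add: chart_def smooth_on_def)
  obtain g where g: "homeomorphism U (f ` U) f g" using c by (auto simp: chart_def)
  then have gf: "\<And>v. v \<in> U \<Longrightarrow> g (f v) = v" by (auto simp: homeomorphism_def)
  obtain c0 where c0: "c0 > 0" "\<And>h. c0 * norm h \<le> norm (chdiff f u h)"
    using linear_inj_bounded_below_pos[OF linear_chdiff inj_chdiff[OF c u]] by (metis mult.commute)
  obtain P where P: "linear P" "P \<circ> chdiff f u = id"
    using linear_injective_left_inverse[OF linear_chdiff inj_chdiff[OF c u]] by blast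
  have Pc: "P (chdiff f u h) = h" for h using P(2) by (metis comp_apply id_apply)
  have blP: "bounded_linear P" using P(1) by (rule linear_conv_bounded_linear[THEN iffD1])
  obtain K where K: "K > 0" "\<And>x. norm (P x) \<le> norm x * K"
    using bounded_linear.pos_bounded[OF blP] by blast
  have "(g has_derivative P) (at (f u) within S)"
    unfolding has_derivative_within_alt2
  proof (intro conjI allI impI blP)
    fix e :: real assume e: "e > 0"
    \<comment> \<open>The bound \<open>c0/2\<close> lets the remainder be absorbed into the lower
      bound for the differential; the other bound makes the image of the remainder under
      \<open>P\<close>, of size at most \<open>K * \<epsilon> * norm h\<close>, small against
      \<open>e * norm (y - f u)\<close>.\<close>
    define \<epsilon> where "\<epsilon> = min (c0/2) (e * c0 / (2 * K))"
    have eps: "\<epsilon> > 0" "\<epsilon> \<le> c0/2" "K * \<epsilon> \<le> e * c0/2"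
    proof -
      show "\<epsilon> > 0" "\<epsilon> \<le> c0/2" using e c0(1) K(1) by (auto simp: \<epsilon>_def)
      have "K * \<epsilon> \<le> K * (e * c0 / (2 * K))" using K(1) by (intro mult_left_mono) (auto simp: \<epsilon>_def)
      then show "K * \<epsilon> \<le> e * c0/2" using K(1) by simp
    qed
    have "\<exists>d>0. \<forall>v\<in>UNIV. norm (v - u) < d \<longrightarrow> norm (f v - f u - chdiff f u (v - u)) \<le> \<epsilon> * norm (v - u)"
      using chart_has_derivative(1)[OF c u] eps(1) unfolding has_derivative_within_alt by blast
    then obtain d where d: "d > 0"
      "\<And>v. norm (v - u) < d \<Longrightarrow> norm (f v - f u - chdiff f u (v - u)) \<le> \<epsilon> * norm (v - u)"
      by blast
    have "continuous (at (f u) within f ` U) g"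
      using g u by (auto simp: homeomorphism_def continuous_on_eq_continuous_within)
    then have "eventually (\<lambda>y. dist (g y) (g (f u)) < d) (at (f u) within f ` U)"
      using d(1) by (auto simp: continuous_within tendsto_iff)
    then have ev: "eventually (\<lambda>y. dist (g y) u < d) (at (f u) within f ` U)"
      by (simp add: gf[OF u])
    have ev': "eventually (\<lambda>y. y \<in> f ` U) (at (f u) within f ` U)"
      unfolding eventually_at_filter by simp
    obtain O' where O': "open O'" "f ` U = S \<inter> O'" using c unfolding chart_def openin_open by blast
    have "at (f u) within f ` U = at (f u) within S"
      by (rule at_within_nhd[of _ O']) (use O' u in blast)+
    note ev[unfolded this] ev'[unfolded this]
    then show "eventually (\<lambda>y. norm (g y - g (f u) - P (y - f u)) \<le> e * norm (y - f u)) (at (f u) within S)"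
    proof eventually_elim
      case (elim y)
      then obtain v where v: "v \<in> U" "y = f v" by blast
      define h where "h = v - u"
      define r where "r = f v - f u - chdiff f u h"
      have r: "norm r \<le> \<epsilon> * norm h"
        using d(2)[of v] elim v gf by (simp add: r_def h_def dist_norm)
      have "P (y - f u) = P (chdiff f u h + r)" by (simp add: r_def v)
      also have "\<dots> = h + P r" by (simp add: linear_add[OF P(1)] Pc)
      finally have "norm (g y - g (f u) - P (y - f u)) = norm (P r)"
        using v u gf by (simp add: h_def)
      also have "\<dots> \<le> K * \<epsilon> * norm h"
        using order_trans[OF K(2)[of r] mult_right_mono[OF r less_imp_le[OF K(1)]]] by (simp add: ac_simps)
      also have "\<dots> \<le> e * c0 / 2 * norm h" using eps by (intro mult_right_mono) auto
      also have "\<dots> \<le> e * norm (y - f u)"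
      proof -
        have "c0 * norm h \<le> norm (y - f u - r)" using c0(2)[of h] by (simp add: r_def v)
        also have "\<dots> \<le> norm (y - f u) + c0/2 * norm h"
          using norm_triangle_ineq4[of "y - f u" r] r mult_right_mono[OF eps(2) norm_ge_zero[of h]] by linarith
        finally have "c0 / 2 * norm h \<le> norm (y - f u)" by simp
        then show ?thesis using e by (simp add: mult.assoc mult_left_mono)
      qed
      finally show ?case .
    qed
  qed
  with gf Pc show ?thesis using that by blast
qed

lemma chart_inverse_right:
  assumes c: "chart S U f" and u: "u \<in> U" and gf: "\<And>v. v \<in> U \<Longrightarrow> g (f v) = v"
  shows "eventually (\<lambda>y. g y \<in> U \<and> f (g y) = y) (at (f u) within S)"
proof -
  obtain O' where "open O'" "f ` U = S \<inter> O'" using c by (auto simp: chart_def openin_open)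
  then have "y \<in> S \<Longrightarrow> y \<in> O' \<Longrightarrow> g y \<in> U \<and> f (g y) = y" for y
    using gf by (metis IntI imageE)
  moreover have "f u \<in> O'" using \<open>f ` U = S \<inter> O'\<close> u by blast
  ultimately show ?thesis
    unfolding eventually_at_topological using \<open>open O'\<close> by blast
qed

text \<open>Near \<open>f u\<close> the map \<open>f \<circ> g\<close> is the identity of
  \<open>S\<close>, so by the chain rule each one-sided tangent vector \<open>v\<close> equals
  \<open>chdiff f u (P v)\<close>; conversely, segments in the parameter domain give curves. In
  particular all charts through a point have the same tangent plane.\<close>

lemma chart_tang:
  assumes c: "chart S U f" and u: "u \<in> U"
  shows "tang S (f u) = range (chdiff f u)"
proof (intro set_eqI iffI)
  fix v assume "v \<in> tang S (f u)"
  then obtain \<gamma> where gam: "\<gamma> 0 = f u" "\<forall>t\<ge>0. \<gamma> t \<in> S"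
    "(\<gamma> has_vector_derivative v) (at 0 within {0..})" by (auto simp: tang_def)
  obtain g P where g: "\<And>v. v \<in> U \<Longrightarrow> g (f v) = v" "(g has_derivative P) (at (f u) within S)"
    using chart_inverse[OF c u] by metis
  have "(f has_derivative chdiff f u) (at (g (f u)))"
    using chart_has_derivative(1)[OF c u] g(1) u by simp
  from has_derivative_compose[OF g(2) this]
  have "((\<lambda>y. f (g y)) has_derivative (\<lambda>h. chdiff f u (P h))) (at (f u) within S)" .
  moreover have "eventually (\<lambda>y. f (g y) = y) (at (f u) within S)"
    using chart_inverse_right[OF c u g(1)] by (rule eventually_mono) auto
  moreover have "f (g (f u)) = f u" "f u \<in> S" using g(1)[OF u] c u by (auto simp: chart_def)
  ultimately have "((\<lambda>y. y) has_derivative (\<lambda>h. chdiff f u (P h))) (at (f u) within S)"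
    by (rule has_derivative_transform_eventually)
  from tang_compose[OF this gam] have "v = chdiff f u (P v)"
    using one_sided_vector_derivative_unique[OF gam(3)] by blast
  then show "v \<in> range (chdiff f u)" by blast
next
  fix v assume "v \<in> range (chdiff f u)"
  then obtain h where h: "v = chdiff f u h" by blast
  have U: "open U" using c by (simp add: chart_def smooth_on_def)
  have line: "((\<lambda>t. u + t *\<^sub>R h) has_derivative (\<lambda>t. t *\<^sub>R h)) (at 0 within {0..})"
    by (auto intro!: derivative_eq_intros)
  have "((\<lambda>t. f (u + t *\<^sub>R h)) has_vector_derivative v) (at (0::real) within {0..})"
    using has_derivative_compose[OF line, of f "chdiff f u"] chart_has_derivative(1)[OF c u]
    by (simp add: has_vector_derivative_def h linear_cmul[OF linear_chdiff])
  moreover have "\<exists>d>0. \<forall>t. 0 \<le> t \<and> t < d \<longrightarrow> u + t *\<^sub>R h \<in> U"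
  proof -
    obtain e where e: "e > 0" "ball u e \<subseteq> U" using U u openE by blast
    have "u + t *\<^sub>R h \<in> ball u e" if "0 \<le> t" "t < e / (norm h + 1)" for t
    proof -
      have "t * norm h \<le> t * (norm h + 1)" using that by (simp add: mult_left_mono)
      also have "\<dots> < e" using that by (simp add: pos_less_divide_eq add_nonneg_pos)
      finally show ?thesis using that by (simp add: dist_norm)
    qed
    then show ?thesis using e by (intro exI[of _ "e / (norm h + 1)"]) (auto simp: add_nonneg_pos)
  qed
  then obtain d where "d > 0" "\<And>t. 0 \<le> t \<Longrightarrow> t < d \<Longrightarrow> u + t *\<^sub>R h \<in> U" by blast
  ultimately show "v \<in> tang S (f u)"
    using c by (intro tangI_eventually[of "\<lambda>t. f (u + t *\<^sub>R h)" _ d]) (auto simp: chart_def)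
qed

section \<open>Lagrangian frames and the tangential projection\<close>

lemma tang_derivative_eventually_const:
  assumes g: "(g has_derivative D) (at x within S)"
    and ev: "eventually (\<lambda>y. g y = c) (at x within S)" "g x = c" "x \<in> S" and v: "v \<in> tang S x"
  shows "D v = 0"
proof -
  have "((\<lambda>_. c) has_derivative D) (at x within S)"
    by (rule has_derivative_transform_eventually[OF g ev])
  from tang_derivative_const[OF this refl v] show ?thesis .
qed

section \<open>The complex structure, unitary bases and tangent planes\<close>

lemma cJ_inner [simp]: "inner (cJ u) (cJ v) = inner u v"
  by (simp add: cJ_def inner_prod_def inner_complex_def)

lemma cJ_cJ [simp]: "cJ (cJ v) = - v"
  by (simp add: cJ_def prod_eq_iff)

lemma cJ_inner_left: "inner (cJ u) v = - inner u (cJ v)"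
  by (simp add: cJ_def inner_prod_def inner_complex_def algebra_simps)

lemma cJ_inner_self [simp]: "inner v (cJ v) = 0" "inner (cJ v) v = 0"
  by (simp_all add: cJ_def inner_prod_def inner_complex_def)

lemma bounded_linear_cJ: "bounded_linear cJ"
  unfolding cJ_def by (intro bounded_linear_Pair bounded_linear_const_mult bounded_linear_fst bounded_linear_snd)

lemmas cJ_linear [simp] = linear_add[OF bounded_linear.linear[OF bounded_linear_cJ]]
  linear_diff[OF bounded_linear.linear[OF bounded_linear_cJ]]
  linear_cmul[OF bounded_linear.linear[OF bounded_linear_cJ]]
  linear_neg[OF bounded_linear.linear[OF bounded_linear_cJ]]
  linear_0[OF bounded_linear.linear[OF bounded_linear_cJ]]

text \<open>Hermitian orthonormality: \<open>e1\<close>, \<open>e2\<close>, \<open>cJ e1\<close>,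
  \<open>cJ e2\<close> then form an orthonormal basis of the real four-space.\<close>

definition unitary_pair :: "C2 \<Rightarrow> C2 \<Rightarrow> bool" where
  "unitary_pair e1 e2 \<longleftrightarrow> inner e1 e1 = 1 \<and> inner e2 e2 = 1 \<and> inner e1 e2 = 0 \<and> inner e1 (cJ e2) = 0"

lemma unitary_pair_inner:
  assumes "unitary_pair e1 e2"
  shows "inner e1 e1 = 1" "inner e2 e2 = 1" "inner e1 e2 = 0" "inner e2 e1 = 0"
    "inner e1 (cJ e2) = 0" "inner (cJ e2) e1 = 0" "inner e2 (cJ e1) = 0" "inner (cJ e1) e2 = 0"
  using assms cJ_inner_left[of e1 e2] cJ_inner_left[of e2 e1]
  by (auto simp: unitary_pair_def inner_commute)

lemma unitary_expand:
  assumes "unitary_pair e1 e2"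
  shows "inner z e1 *\<^sub>R e1 + inner z e2 *\<^sub>R e2 + inner z (cJ e1) *\<^sub>R cJ e1 + inner z (cJ e2) *\<^sub>R cJ e2 = z"
proof -
  note i = unitary_pair_inner[OF assms]
  define B where "B = {e1, e2, cJ e1, cJ e2}"
  have d: "e1 \<noteq> e2" "e1 \<noteq> cJ e1" "e1 \<noteq> cJ e2" "e2 \<noteq> cJ e1" "e2 \<noteq> cJ e2" "cJ e1 \<noteq> cJ e2"
    using i by (metis zero_neq_one cJ_inner_self cJ_inner)+
  have orth: "pairwise orthogonal B"
    using i by (auto simp: B_def pairwise_def orthogonal_def)
  have n: "norm v = 1" if "v \<in> B" for v using that i by (auto simp: B_def norm_eq_1)
  have "independent B" using orth n[of 0] by (intro pairwise_orthogonal_independent) (metis norm_zero zero_neq_one)+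
  moreover have "card B = DIM(C2)" using d by (simp add: B_def)
  ultimately have "span B = UNIV"
    by (simp add: dim_eq_card_independent flip: dim_eq_full)
  then have "(\<Sum>v\<in>B. inner z v *\<^sub>R v) = z"
    using orth n by (intro orthonormal_basis_expand) (auto simp: B_def)
  then show ?thesis using d by (simp add: B_def add_ac)
qed

lemma unitary_eqI:
  assumes "unitary_pair e1 e2" "inner z e1 = inner w e1" "inner z e2 = inner w e2"
    "inner z (cJ e1) = inner w (cJ e1)" "inner z (cJ e2) = inner w (cJ e2)"
  shows "z = w"
  using unitary_expand[OF assms(1), of z] unitary_expand[OF assms(1), of w] unfolding assms(2-) by (rule trans[OF sym])

lemma unitary_inner_expand:
  assumes "unitary_pair e1 e2"
  shows "inner z w = inner z e1 * inner w e1 + inner z e2 * inner w e2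
    + inner z (cJ e1) * inner w (cJ e1) + inner z (cJ e2) * inner w (cJ e2)"
proof -
  have "inner z w = inner z (inner w e1 *\<^sub>R e1 + inner w e2 *\<^sub>R e2 + inner w (cJ e1) *\<^sub>R cJ e1 + inner w (cJ e2) *\<^sub>R cJ e2)"
    by (simp only: unitary_expand[OF assms])
  also have "\<dots> = inner z e1 * inner w e1 + inner z e2 * inner w e2
    + inner z (cJ e1) * inner w (cJ e1) + inner z (cJ e2) * inner w (cJ e2)"
    by (simp add: inner_add_right mult.commute)
  finally show ?thesis .
qed

text \<open>Described through \<open>S\<close> alone, so that fields built from it are defined on
  all of \<open>S\<close> and can be differentiated within \<open>S\<close> as the base point
  varies.\<close>

definition tproj :: "C2 set \<Rightarrow> C2 \<Rightarrow> C2 \<Rightarrow> C2" where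
  "tproj S x z = (THE w. w \<in> tang S x \<and> (\<forall>v\<in>tang S x. inner (z - w) v = 0))"

definition frame :: "C2 set \<Rightarrow> C2 \<Rightarrow> C2 \<Rightarrow> C2 \<Rightarrow> bool" where
  "frame S x e1 e2 \<longleftrightarrow> unitary_pair e1 e2 \<and> tang S x = {a *\<^sub>R e1 + b *\<^sub>R e2 | a b. True}"

text \<open>Cramer's rule for the Gram matrix. The basis is not assumed orthonormal, because vectors
  with constant chart coordinates are orthonormal at one chosen point and in general not beside
  it.\<close>

lemma tproj_basis:
  assumes tan: "tang S x = {a *\<^sub>R e1 + b *\<^sub>R e2 | a b. True}"
    and d: "inner e1 e1 * inner e2 e2 - (inner e1 e2)\<^sup>2 \<noteq> 0"
  defines "w z \<equiv> ((inner e2 e2 * inner z e1 - inner e1 e2 * inner z e2) / (inner e1 e1 * inner e2 e2 - (inner e1 e2)\<^sup>2)) *\<^sub>R e1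
     + ((inner e1 e1 * inner z e2 - inner e1 e2 * inner z e1) / (inner e1 e1 * inner e2 e2 - (inner e1 e2)\<^sup>2)) *\<^sub>R e2"
  shows "tproj S x z = w z" "inner (z - w z) e1 = 0" "inner (z - w z) e2 = 0"
proof -
  let ?d = "inner e1 e1 * inner e2 e2 - (inner e1 e2)\<^sup>2"
  have "?d * inner (w z) e1 = ?d * inner z e1" "?d * inner (w z) e2 = ?d * inner z e2"
  proof -
    define \<alpha> where "\<alpha> = (inner e2 e2 * inner z e1 - inner e1 e2 * inner z e2) / ?d"
    define \<beta> where "\<beta> = (inner e1 e1 * inner z e2 - inner e1 e2 * inner z e1) / ?d"
    have "?d * \<alpha> = inner e2 e2 * inner z e1 - inner e1 e2 * inner z e2"
      "?d * \<beta> = inner e1 e1 * inner z e2 - inner e1 e2 * inner z e1"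
      using d by (simp_all add: \<alpha>_def \<beta>_def)
    moreover have "inner (w z) e1 = \<alpha> * inner e1 e1 + \<beta> * inner e1 e2"
      "inner (w z) e2 = \<alpha> * inner e1 e2 + \<beta> * inner e2 e2"
      by (simp_all add: w_def \<alpha>_def \<beta>_def inner_add_left inner_commute[of e2 e1])
    ultimately show "?d * inner (w z) e1 = ?d * inner z e1" "?d * inner (w z) e2 = ?d * inner z e2"
      by algebra+
  qed
  then show 1: "inner (z - w z) e1 = 0" "inner (z - w z) e2 = 0"
    using d by (simp_all add: inner_diff_left)
  have wt: "w z \<in> tang S x" unfolding tan w_def by blast
  show "tproj S x z = w z" unfolding tproj_def
  proof (rule the_equality)
    show "w z \<in> tang S x \<and> (\<forall>v\<in>tang S x. inner (z - w z) v = 0)"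
      using wt 1 by (auto simp: tan inner_add_right)
  next
    fix w' assume w': "w' \<in> tang S x \<and> (\<forall>v\<in>tang S x. inner (z - w') v = 0)"
    obtain a b where "w z = a *\<^sub>R e1 + b *\<^sub>R e2" using wt tan by blast
    moreover obtain a' b' where "w' = a' *\<^sub>R e1 + b' *\<^sub>R e2" using w' tan by blast
    ultimately have df: "w z - w' = (a - a') *\<^sub>R e1 + (b - b') *\<^sub>R e2" by (simp add: algebra_simps)
    then have t: "w z - w' \<in> tang S x" unfolding tan by blast
    have "inner (z - w z) (w z - w') = 0" unfolding df using 1 by (simp add: inner_add_right)
    moreover have "inner (z - w') (w z - w') = 0" using w' t by blast
    ultimately have "inner (w z - w') (w z - w') = 0" by (simp add: inner_diff_left)
    then show "w' = w z" by simp
  qed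
qed

lemma tproj_frame:
  assumes "frame S x e1 e2"
  shows "tproj S x z = inner z e1 *\<^sub>R e1 + inner z e2 *\<^sub>R e2"
proof -
  have u: "unitary_pair e1 e2" and tan: "tang S x = {a *\<^sub>R e1 + b *\<^sub>R e2 | a b. True}"
    using assms by (auto simp: frame_def)
  show ?thesis
    using tproj_basis(1)[OF tan, of z] by (simp add: unitary_pair_inner[OF u])
qed

lemma tang_frame_iff:
  assumes "frame S x e1 e2"
  shows "v \<in> tang S x \<longleftrightarrow> v = inner v e1 *\<^sub>R e1 + inner v e2 *\<^sub>R e2"
  using assms by (auto simp: frame_def inner_add_left unitary_pair_inner)

lemma frame_tang:
  assumes "frame S x e1 e2"
  shows "e1 \<in> tang S x" "e2 \<in> tang S x"
proof -
  have "unitary_pair e1 e2" using assms by (simp add: frame_def)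
  then show "e1 \<in> tang S x" "e2 \<in> tang S x"
    by (simp_all add: tang_frame_iff[OF assms] unitary_pair_inner)
qed

lemma lagrangian_chdiff:
  assumes "lagrangian S" "chart S U f" "u \<in> U"
  shows "inner (chdiff f u h) (cJ (chdiff f u k)) = 0"
proof -
  have "inner (cJ (pd True f u)) (pd False f u) = 0"
    using assms by (auto simp: lagrangian_def kahler_def)
  then have "inner (pd True f u) (cJ (pd False f u)) = 0" "inner (pd False f u) (cJ (pd True f u)) = 0"
    using cJ_inner_left[of "pd True f u" "pd False f u"] inner_commute[of "cJ (pd True f u)" "pd False f u"]
    by simp_all
  then show ?thesis by (simp add: chdiff_def inner_add_left inner_add_right)
qed

lemma embedded_surface_tang:
  assumes "embedded_surface S" "x \<in> S"
  shows "subspace (tang S x)" "dim (tang S x) = 2"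
proof -
  obtain U f u where c: "chart S U f" "u \<in> U" "x = f u"
    using assms unfolding embedded_surface_def by blast
  have t: "tang S x = range (chdiff f u)" using chart_tang[OF c(1,2)] c(3) by simp
  show "subspace (tang S x)" unfolding t
    using linear_subspace_image[OF linear_chdiff subspace_UNIV] .
  have "dim (range (chdiff f u)) = dim (UNIV :: R2 set)"
    using inj_chdiff[OF c(1,2)] by (intro dim_image_eq linear_chdiff) (simp add: inj_on_def)
  then show "dim (tang S x) = 2" by (simp add: t)
qed

lemma lagrangian_tang:
  assumes "embedded_surface S" "lagrangian S" "x \<in> S" "v \<in> tang S x" "w \<in> tang S x"
  shows "inner v (cJ w) = 0"
proof -
  obtain U f u where c: "chart S U f" "u \<in> U" "x = f u"
    using assms unfolding embedded_surface_def by blast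
  then show ?thesis using assms chart_tang[OF c(1,2)] lagrangian_chdiff[OF assms(2) c(1,2)] by auto
qed

lemma frameI:
  assumes "embedded_surface S" "lagrangian S" "x \<in> S" "e1 \<in> tang S x" "e2 \<in> tang S x"
    "inner e1 e1 = 1" "inner e2 e2 = 1" "inner e1 e2 = 0"
  shows "frame S x e1 e2"
proof -
  have u: "unitary_pair e1 e2"
    using assms lagrangian_tang[OF assms(1-5)] by (simp add: unitary_pair_def)
  have ne: "e1 \<noteq> e2" using assms by auto
  have "independent {e1, e2}"
    using assms ne by (intro pairwise_orthogonal_independent) (auto simp: pairwise_def orthogonal_def inner_commute)
  then have "dim (span {e1, e2}) = 2" using ne by (simp add: dim_eq_card_independent)
  then have "span {e1, e2} = tang S x"
    using embedded_surface_tang[OF assms(1,3)] assms(4,5)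
    by (intro subspace_dim_equal subspace_span span_minimal) auto
  moreover have "span {e1, e2} = {a *\<^sub>R e1 + b *\<^sub>R e2 | a b. True}"
    by (auto simp: span_breakdown_eq algebra_simps) (metis add.commute add_diff_cancel_left')+
  ultimately show ?thesis using u by (simp add: frame_def)
qed

lemma frame_extend:
  assumes S: "embedded_surface S" "lagrangian S" "x \<in> S" and e1: "e1 \<in> tang S x" "inner e1 e1 = 1"
  obtains e2 where "frame S x e1 e2"
proof -
  note sub = embedded_surface_tang[OF S(1,3)]
  have "\<not> tang S x \<subseteq> span {e1}"
  proof
    assume "tang S x \<subseteq> span {e1}"
    then have "dim (tang S x) \<le> dim {e1}" by (rule dim_mono)
    also have "\<dots> \<le> card {e1}" by (rule dim_le_card') simp
    finally show False using sub by simp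
  qed
  then obtain v where v: "v \<in> tang S x" "v \<notin> span {e1}" by blast
  define w where "w = v - inner v e1 *\<^sub>R e1"
  have "w \<noteq> 0"
    using v unfolding w_def by (metis eq_iff_diff_eq_0 insertI1 span_base span_scale)
  have "w \<in> tang S x"
    unfolding w_def by (intro subspace_diff subspace_scale sub v e1)
  then have "(1 / norm w) *\<^sub>R w \<in> tang S x" by (intro subspace_scale sub)
  moreover have "inner e1 w = 0" by (simp add: w_def inner_diff_right e1 inner_commute)
  ultimately have "frame S x e1 ((1 / norm w) *\<^sub>R w)"
    using \<open>w \<noteq> 0\<close> e1 by (intro frameI[OF S e1(1)]) (auto simp: dot_square_norm power2_eq_square)
  then show ?thesis by (rule that)
qed

lemma frame_exists:
  assumes S: "embedded_surface S" "lagrangian S" "x \<in> S"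
  obtains e1 e2 where "frame S x e1 e2"
proof -
  note sub = embedded_surface_tang[OF S(1,3)]
  have "\<not> tang S x \<subseteq> {0}"
    using sub(2) by (metis dim_eq_0 zero_neq_numeral)
  then obtain v where v: "v \<in> tang S x" "v \<noteq> 0" by blast
  have "(1 / norm v) *\<^sub>R v \<in> tang S x" by (intro subspace_scale sub v)
  moreover have "inner ((1 / norm v) *\<^sub>R v) ((1 / norm v) *\<^sub>R v) = 1"
    using v by (simp add: dot_square_norm power2_eq_square)
  ultimately show ?thesis using frame_extend[OF S] that by blast
qed

section \<open>Comparison of the coordinate definitions with the intrinsic ones\<close>

lemma has_derivative_pd:
  assumes "(Y has_derivative L) (at u)"
  shows "pd i Y u = L (dir i)"
proof -
  have line: "((\<lambda>t. u + t *\<^sub>R dir i) has_derivative (\<lambda>t. t *\<^sub>R dir i)) (at 0)"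
    by (auto intro!: derivative_eq_intros)
  have "((\<lambda>t. Y (u + t *\<^sub>R dir i)) has_derivative (\<lambda>t. L (t *\<^sub>R dir i))) (at (0::real))"
    using has_derivative_compose[OF line, of Y L] assms by simp
  then show ?thesis
    unfolding pd_def
    by (intro vector_derivative_at)
      (simp add: has_vector_derivative_def linear_cmul[OF has_derivative_linear[OF assms]])
qed

lemma chdiff_dir: "chdiff f u (dir i) = pd i f u"
  by (simp add: chdiff_def dir_def)

lemma tanproj_eq_tproj:
  assumes "chart S U f" "u \<in> U"
  shows "tanproj f u z = tproj S (f u) z"
proof -
  define E where "E = inner (pd True f u) (pd True f u)"
  define F where "F = inner (pd True f u) (pd False f u)"
  define G where "G = inner (pd False f u) (pd False f u)"
  have tan: "tang S (f u) = {a *\<^sub>R pd True f u + b *\<^sub>R pd False f u | a b. True}"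
    unfolding chart_tang[OF assms] by (auto simp: chdiff_def image_def)
  have inj: "chdiff f u h = 0 \<Longrightarrow> h = 0" for h
    using linear_injective_0[OF linear_chdiff] inj_chdiff[OF assms] by blast
  \<comment> \<open>This vector is orthogonal to \<open>pd True f u\<close>, and its squared length
    exhibits the Gram determinant as nonzero.\<close>
  have "inner (chdiff f u (F, - E)) (chdiff f u (F, - E)) = E * (E * G - F\<^sup>2)"
    unfolding E_def F_def G_def
    by (simp add: chdiff_def inner_add_left inner_add_right inner_diff_left inner_diff_right
        inner_commute[of "pd False f u" "pd True f u"] algebra_simps power2_eq_square)
  moreover have "E \<noteq> 0"
    using inj[of "(1, 0)"] by (auto simp: chdiff_def E_def zero_prod_def)
  moreover have "chdiff f u (F, - E) \<noteq> 0" using inj[of "(F, - E)"] \<open>E \<noteq> 0\<close> by (auto simp: zero_prod_def)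
  ultimately have d: "E * G - F\<^sup>2 \<noteq> 0" by auto
  have "tanproj f u z =
     ((G / (E * G - F\<^sup>2)) * inner z (pd True f u) + (- F / (E * G - F\<^sup>2)) * inner z (pd False f u)) *\<^sub>R pd True f u
     + ((E / (E * G - F\<^sup>2)) * inner z (pd False f u) + (- F / (E * G - F\<^sup>2)) * inner z (pd True f u)) *\<^sub>R pd False f u"
    by (simp add: tanproj_def UNIV_bool ginv_def gmet_def Let_def scaleR_add_left scaleR_diff_left flip: E_def F_def G_def)
  also have "\<dots> = ((G * inner z (pd True f u) - F * inner z (pd False f u)) / (E * G - F\<^sup>2)) *\<^sub>R pd True f u
     + ((E * inner z (pd False f u) - F * inner z (pd True f u)) / (E * G - F\<^sup>2)) *\<^sub>R pd False f u"
    by (simp add: diff_divide_distrib)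
  finally show ?thesis
    using tproj_basis(1)[OF tan, of z] d unfolding E_def F_def G_def by simp
qed

text \<open>In terms of a frame \<open>e\<^sub>i = \<Sum>\<^sub>j c\<^sub>i\<^sub>j f\<^sub>j\<close>, the inverse metric is \<open>c\<^sup>T c\<close>.\<close>

lemma ginv_trace:
  assumes "unitary_pair (chdiff f u c) (chdiff f u d)"
  shows "ginv f u True True * b True True + ginv f u True False * b True False
    + ginv f u False True * b False True + ginv f u False False * b False False
   = (fst c * fst c * b True True + fst c * snd c * b True False + snd c * fst c * b False True + snd c * snd c * b False False)
   + (fst d * fst d * b True True + fst d * snd d * b True False + snd d * fst d * b False True + snd d * snd d * b False False)"
proof -
  define E where "E = inner (pd True f u) (pd True f u)"
  define F where "F = inner (pd True f u) (pd False f u)"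
  define G where "G = inner (pd False f u) (pd False f u)"
  obtain c1 c2 where c: "c = (c1, c2)" by (cases c)
  obtain d1 d2 where d: "d = (d1, d2)" by (cases d)
  have 1: "c1 * c1 * E + 2 * c1 * c2 * F + c2 * c2 * G = 1"
    "d1 * d1 * E + 2 * d1 * d2 * F + d2 * d2 * G = 1"
    "c1 * d1 * E + (c1 * d2 + c2 * d1) * F + c2 * d2 * G = 0"
    using unitary_pair_inner[OF assms] unfolding c d
unfolding E_def F_def G_def
    by (simp_all add: chdiff_def inner_add_left inner_add_right inner_commute[of "pd False f u" "pd True f u"] algebra_simps)
  define \<Delta> where "\<Delta> = E * G - F\<^sup>2"
  \<comment> \<open>Determinants in the matrix form of the three relations: coefficient matrix times
    metric times transpose is the identity.\<close>
  have D: "(c1 * d2 - c2 * d1)\<^sup>2 * \<Delta> = 1"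
    using 1 unfolding \<Delta>_def by algebra
  then have "\<Delta> \<noteq> 0" by auto
  have "G = (c1 * c1 + d1 * d1) * \<Delta>" "E = (c2 * c2 + d2 * d2) * \<Delta>" "- F = (c1 * c2 + d1 * d2) * \<Delta>"
    using 1 D unfolding \<Delta>_def by algebra+
  then have 2: "G / \<Delta> = c1 * c1 + d1 * d1" "E / \<Delta> = c2 * c2 + d2 * d2" "F / \<Delta> = - (c1 * c2 + d1 * d2)"
    using \<open>\<Delta> \<noteq> 0\<close> by (simp_all add: field_simps)
  have "ginv f u True True = G / \<Delta>" "ginv f u False False = E / \<Delta>"
    "ginv f u True False = - F / \<Delta>" "ginv f u False True = - F / \<Delta>"
    by (simp_all add: ginv_def gmet_def Let_def E_def F_def G_def \<Delta>_def)
  then show ?thesis by (simp add: 2 c d algebra_simps)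
qed

section \<open>Structure equations\<close>

definition hess :: "(R2 \<Rightarrow> C2) \<Rightarrow> R2 \<Rightarrow> R2 \<Rightarrow> R2 \<Rightarrow> C2" where
  "hess f u h k = fst k *\<^sub>R chdiff (pd True f) u h + snd k *\<^sub>R chdiff (pd False f) u h"

lemma hess_sym:
  assumes "chart S U f" "u \<in> U"
  shows "hess f u h k = hess f u k h"
  using chart_mixed_partials[OF assms, of True False]
  by (simp add: hess_def chdiff_def algebra_simps)

lemma chdiff_has_derivative:
  assumes "chart S U f" "u \<in> U"
  shows "((\<lambda>v. chdiff f v k) has_derivative (\<lambda>h. hess f u h k)) (at u)"
  unfolding chdiff_def[of f] hess_def
  by (intro has_derivative_add has_derivative_scaleR_right chart_has_derivative(2)[OF assms])

text \<open>The derivative of the Lagrangian condition in direction \<open>h\<close>. Together with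
  \<open>hess_sym\<close> it makes the cubic form of the surface symmetric in all three arguments,
  so four components describe it.\<close>

lemma lagrangian_hess:
  assumes "lagrangian S" "chart S U f" "u \<in> U"
  shows "inner (hess f u h k) (cJ (chdiff f u l)) = inner (hess f u h l) (cJ (chdiff f u k))"
proof -
  have U: "open U" using assms by (simp add: chart_def smooth_on_def)
  note 1 = has_derivative_inner[OF chdiff_has_derivative[OF assms(2,3), of k]
      bounded_linear.has_derivative[OF bounded_linear_cJ chdiff_has_derivative[OF assms(2,3), of l]]]
  have 2: "((\<lambda>v. inner (chdiff f v k) (cJ (chdiff f v l))) has_derivative (\<lambda>_. 0)) (at u)"
    by (rule has_derivative_transform_within_open[OF has_derivative_const[of 0] U assms(3)])
      (simp add: lagrangian_chdiff[OF assms(1,2)])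
  have "inner (chdiff f u k) (cJ (hess f u h l)) + inner (hess f u h k) (cJ (chdiff f u l)) = 0"
    using fun_cong[OF has_derivative_unique[OF 1 2], of h] .
  then show ?thesis
    using cJ_inner_left[of "chdiff f u k" "hess f u h l"]
      inner_commute[of "hess f u h l" "cJ (chdiff f u k)"] by linarith
qed

text \<open>Extend the frame to \<open>S\<close> with constant chart coordinates and write the
  projection as \<open>t1 y *\<^sub>R E1 y + t2 y *\<^sub>R E2 y\<close>. Normal components of its
  derivative come only from differentiating \<open>E1\<close> and \<open>E2\<close>; tangential ones
  follow by differentiating the orthogonality of \<open>Z y - w y\<close> to \<open>E1 y\<close> and
  \<open>E2 y\<close>.\<close>

lemma tproj_has_derivative:
  assumes c: "chart S U f" and u: "u \<in> U" and lag: "lagrangian S"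
    and fr: "frame S (f u) e1 e2" and e: "e1 = chdiff f u c" "e2 = chdiff f u d"
    and Z: "(Z has_derivative Z') (at (f u) within S)"
  obtains D where "((\<lambda>y. tproj S y (Z y)) has_derivative D) (at (f u) within S)"
    "\<And>h. inner (D (chdiff f u h)) e1 = inner (Z' (chdiff f u h)) e1 + inner (Z (f u) - tproj S (f u) (Z (f u))) (hess f u h c)"
    "\<And>h. inner (D (chdiff f u h)) e2 = inner (Z' (chdiff f u h)) e2 + inner (Z (f u) - tproj S (f u) (Z (f u))) (hess f u h d)"
    "\<And>h. inner (D (chdiff f u h)) (cJ e1) = inner (Z (f u)) e1 * inner (hess f u h c) (cJ e1) + inner (Z (f u)) e2 * inner (hess f u h d) (cJ e1)"
    "\<And>h. inner (D (chdiff f u h)) (cJ e2) = inner (Z (f u)) e1 * inner (hess f u h c) (cJ e2) + inner (Z (f u)) e2 * inner (hess f u h d) (cJ e2)"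
proof -
  define x where "x = f u"
  have up: "unitary_pair e1 e2" and tan: "tang S x = {a *\<^sub>R e1 + b *\<^sub>R e2 | a b. True}"
    using fr by (auto simp: frame_def x_def)
  note i = unitary_pair_inner[OF up]
  obtain g P where gf: "\<And>v. v \<in> U \<Longrightarrow> g (f v) = v" and gd: "(g has_derivative P) (at x within S)"
    and P: "\<And>h. P (chdiff f u h) = h"
    using chart_inverse[OF c u] unfolding x_def by metis
  have right: "eventually (\<lambda>y. g y \<in> U \<and> f (g y) = y) (at x within S)"
    unfolding x_def by (rule chart_inverse_right[OF c u gf])
  have gx: "g x = u" using gf[OF u] by (simp add: x_def)
  have xS: "x \<in> S" using c u by (auto simp: x_def chart_def)
  define E1 where "E1 y = chdiff f (g y) c" for y
  define E2 where "E2 y = chdiff f (g y) d" for y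
  have Ex: "E1 x = e1" "E2 x = e2" by (simp_all add: E1_def E2_def gx e)
  have dE1: "(E1 has_derivative (\<lambda>v. hess f u (P v) c)) (at x within S)"
    unfolding E1_def by (rule has_derivative_compose[OF gd]) (simp add: gx chdiff_has_derivative[OF c u])
  have dE2: "(E2 has_derivative (\<lambda>v. hess f u (P v) d)) (at x within S)"
    unfolding E2_def by (rule has_derivative_compose[OF gd]) (simp add: gx chdiff_has_derivative[OF c u])
  define M where "M y = inner (E1 y) (E1 y) * inner (E2 y) (E2 y) - (inner (E1 y) (E2 y))\<^sup>2" for y
  define t1 where "t1 y = (inner (E2 y) (E2 y) * inner (Z y) (E1 y) - inner (E1 y) (E2 y) * inner (Z y) (E2 y)) / M y" for y
  define t2 where "t2 y = (inner (E1 y) (E1 y) * inner (Z y) (E2 y) - inner (E1 y) (E2 y) * inner (Z y) (E1 y)) / M y" for y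
  have dfl: "E1 differentiable (at x within S)" "E2 differentiable (at x within S)" "Z differentiable (at x within S)"
    using dE1 dE2 Z by (auto simp: differentiable_def x_def)
  have Mx: "M x = 1" by (simp add: M_def Ex i)
  have dM: "M differentiable (at x within S)"
    unfolding M_def by (intro derivative_intros dfl differentiable_inner differentiable_power differentiable_mult differentiable_diff)
  have "t1 differentiable (at x within S)" "t2 differentiable (at x within S)"
    unfolding t1_def t2_def
    by (intro differentiable_inner differentiable_mult differentiable_diff differentiable_divide dM dfl; simp add: Mx)+
  then obtain t1' t2' where t': "(t1 has_derivative t1') (at x within S)" "(t2 has_derivative t2') (at x within S)"
    by (auto simp: differentiable_def)
  have tx: "t1 x = inner (Z x) e1" "t2 x = inner (Z x) e2" by (simp_all add: t1_def t2_def Ex Mx i)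
  have "continuous (at x within S) M" using dM by (rule differentiable_imp_continuous_within)
  then have "eventually (\<lambda>y. M y > 1/2) (at x within S)"
    unfolding continuous_within Mx by (rule order_tendstoD(1)) simp
  then have Mnz: "eventually (\<lambda>y. M y \<noteq> 0) (at x within S)" by (rule eventually_mono) auto
  have cd: "\<exists>a b. k = a *\<^sub>R c + b *\<^sub>R d" for k
  proof -
    have "chdiff f u k \<in> tang S x" using chart_tang[OF c u] by (simp add: x_def)
    then obtain a b where "chdiff f u k = a *\<^sub>R e1 + b *\<^sub>R e2" unfolding tan by blast
    then have "chdiff f u k = chdiff f u (a *\<^sub>R c + b *\<^sub>R d)"
      unfolding e by (simp add: linear_add[OF linear_chdiff] linear_cmul[OF linear_chdiff])
    then show ?thesis using inj_chdiff[OF c u] by (metis injD)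
  qed
  define w where "w y = t1 y *\<^sub>R E1 y + t2 y *\<^sub>R E2 y" for y
  have near: "eventually (\<lambda>y. tproj S y (Z y) = w y \<and> inner (Z y - w y) (E1 y) = 0 \<and> inner (Z y - w y) (E2 y) = 0) (at x within S)"
    using right Mnz
  proof eventually_elim
    case (elim y)
    have gU: "g y \<in> U" and fg: "f (g y) = y" using elim by auto
    have "tang S y = range (chdiff f (g y))" using chart_tang[OF c gU] fg by simp
    also have "\<dots> = {a *\<^sub>R E1 y + b *\<^sub>R E2 y | a b. True}"
    proof (intro set_eqI iffI)
      fix v assume "v \<in> range (chdiff f (g y))"
      then obtain k where "v = chdiff f (g y) k" by blast
      moreover obtain a b where "k = a *\<^sub>R c + b *\<^sub>R d" using cd by blast
      ultimately have "v = a *\<^sub>R E1 y + b *\<^sub>R E2 y"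
        by (simp add: E1_def E2_def linear_add[OF linear_chdiff] linear_cmul[OF linear_chdiff])
      then show "v \<in> {a *\<^sub>R E1 y + b *\<^sub>R E2 y | a b. True}" by blast
    next
      fix v assume "v \<in> {a *\<^sub>R E1 y + b *\<^sub>R E2 y | a b. True}"
      then obtain a b where "v = chdiff f (g y) (a *\<^sub>R c + b *\<^sub>R d)"
        by (auto simp: E1_def E2_def linear_add[OF linear_chdiff] linear_cmul[OF linear_chdiff])
      then show "v \<in> range (chdiff f (g y))" by blast
    qed
    finally have "tang S y = {a *\<^sub>R E1 y + b *\<^sub>R E2 y | a b. True}" .
    from tproj_basis[OF this, of "Z y"] elim(2) show ?case
      by (simp add: w_def t1_def t2_def M_def)
  qed
  have wx: "w x = tproj S x (Z x)"
    using tproj_frame[OF fr, folded x_def] by (simp add: w_def tx Ex)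
  \<comment> \<open>The derivatives \<open>t1'\<close> and \<open>t2'\<close> stay implicit: they
    contribute tangentially, and that part is recovered below from the orthogonality
    relations.\<close>
  define D where "D v = t1' v *\<^sub>R e1 + t1 x *\<^sub>R hess f u (P v) c + (t2' v *\<^sub>R e2 + t2 x *\<^sub>R hess f u (P v) d)" for v
  have wD: "(w has_derivative D) (at x within S)"
    unfolding w_def D_def
    by (rule derivative_eq_intros t' dE1 dE2 refl)+ (simp add: Ex fun_eq_iff algebra_simps)
  have "eventually (\<lambda>y. w y = tproj S y (Z y)) (at x within S)"
    using near by (rule eventually_mono) simp
  from has_derivative_transform_eventually[OF wD this wx xS]
  have main: "((\<lambda>y. tproj S y (Z y)) has_derivative D) (at x within S)" .
  have Zx: "(Z has_derivative Z') (at x within S)" using Z by (simp add: x_def)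
  have o: "inner (Z x - w x) e1 = 0" "inner (Z x - w x) e2 = 0"
    by (simp_all add: w_def tx Ex inner_diff_left inner_add_left i)
  have ht: "chdiff f u h \<in> tang S x" for h using chart_tang[OF c u] by (simp add: x_def)
  have "((\<lambda>y. inner (Z y - w y) (E1 y)) has_derivative (\<lambda>v. inner (Z x - w x) (hess f u (P v) c) + inner (Z' v - D v) (E1 x))) (at x within S)"
    by (intro has_derivative_inner has_derivative_diff Zx wD dE1)
  from tang_derivative_eventually_const[OF this _ _ xS ht, of 0]
  have 1: "inner (Z x - w x) (hess f u h c) + inner (Z' (chdiff f u h) - D (chdiff f u h)) e1 = 0" for h
    using o near by (simp add: Ex P eventually_conj_iff)
  have "((\<lambda>y. inner (Z y - w y) (E2 y)) has_derivative (\<lambda>v. inner (Z x - w x) (hess f u (P v) d) + inner (Z' v - D v) (E2 x))) (at x within S)"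
    by (intro has_derivative_inner has_derivative_diff Zx wD dE2)
  from tang_derivative_eventually_const[OF this _ _ xS ht, of 0]
  have 2: "inner (Z x - w x) (hess f u h d) + inner (Z' (chdiff f u h) - D (chdiff f u h)) e2 = 0" for h
    using o near by (simp add: Ex P eventually_conj_iff)
  show ?thesis
  proof (rule that)
    show "((\<lambda>y. tproj S y (Z y)) has_derivative D) (at (f u) within S)" using main by (simp add: x_def)
    show "inner (D (chdiff f u h)) e1 = inner (Z' (chdiff f u h)) e1 + inner (Z (f u) - tproj S (f u) (Z (f u))) (hess f u h c)" for h
      using 1[of h] by (simp add: inner_diff_left wx x_def[symmetric])
    show "inner (D (chdiff f u h)) e2 = inner (Z' (chdiff f u h)) e2 + inner (Z (f u) - tproj S (f u) (Z (f u))) (hess f u h d)" for h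
      using 2[of h] by (simp add: inner_diff_left wx x_def[symmetric])
  qed (simp_all add: D_def P inner_add_left i tx flip: x_def)
qed

section \<open>The second fundamental form of a Lagrangian self-shrinker\<close>

locale hs_lagrangian_shrinker =
  fixes S :: "C2 set"
  assumes surface: "embedded_surface S"
    and shrinker: "self_shrinker S"
    and lagrangian: "lagrangian S"
    and stationary: "hamiltonian_stationary S"
begin

text \<open>Since \<open>H\<close> is minus the normal part of the position vector, \<open>X\<close> is the field \<open>JH\<close>.\<close>

definition X :: "C2 \<Rightarrow> C2" where "X y = - cJ (y - tproj S y y)"

text \<open>With \<open>p, q, r, s\<close> standing for the components \<open>C\<^sub>1\<^sub>1\<^sub>1, C\<^sub>1\<^sub>1\<^sub>2, C\<^sub>1\<^sub>2\<^sub>2, C\<^sub>2\<^sub>2\<^sub>2\<close> of the symmetric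
  cubic form \<open>C(u,v,w) = \<langle>\<sigma>(u,v), Jw\<rangle>\<close>, this expresses the second fundamental form \<open>\<sigma>\<close> through the
  derivative of the tangential projection.\<close>

definition cubic_form :: "C2 \<Rightarrow> C2 \<Rightarrow> C2 \<Rightarrow> real \<Rightarrow> real \<Rightarrow> real \<Rightarrow> real \<Rightarrow> bool" where
  "cubic_form x e1 e2 p q r s \<longleftrightarrow>
    (\<forall>(Z :: C2 \<Rightarrow> C2) Z'. (Z has_derivative Z') (at x within S) \<longrightarrow>
      (\<exists>D. ((\<lambda>y. tproj S y (Z y)) has_derivative D) (at x within S) \<and>
        inner (D e1) e1 = inner (Z' e1) e1 + p * inner (Z x) (cJ e1) + q * inner (Z x) (cJ e2) \<and>
        inner (D e1) e2 = inner (Z' e1) e2 + q * inner (Z x) (cJ e1) + r * inner (Z x) (cJ e2) \<and>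
        inner (D e1) (cJ e1) = p * inner (Z x) e1 + q * inner (Z x) e2 \<and>
        inner (D e1) (cJ e2) = q * inner (Z x) e1 + r * inner (Z x) e2 \<and>
        inner (D e2) e1 = inner (Z' e2) e1 + q * inner (Z x) (cJ e1) + r * inner (Z x) (cJ e2) \<and>
        inner (D e2) e2 = inner (Z' e2) e2 + r * inner (Z x) (cJ e1) + s * inner (Z x) (cJ e2) \<and>
        inner (D e2) (cJ e1) = q * inner (Z x) e1 + r * inner (Z x) e2 \<and>
        inner (D e2) (cJ e2) = r * inner (Z x) e1 + s * inner (Z x) e2))"

text \<open>The traces \<open>p + r\<close> and \<open>q + s\<close> are the components of
  \<open>H\<close> along \<open>cJ e1\<close> and \<open>cJ e2\<close>, hence those of
  \<open>- X\<close> along the frame. The divergence of \<open>X\<close> is minus the sum of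
  \<open>inner (D e) (cJ e)\<close> over the frame, where \<open>D\<close> differentiates the
  tangential part of the position; by the trace relations this equals
  \<open>inner (X x) (tproj S x x)\<close>.\<close>

lemma structure_equations:
  assumes x: "x \<in> S" and fr: "frame S x e1 e2"
  obtains p q r s where "cubic_form x e1 e2 p q r s"
    "p + r = - inner (X x) e1" "q + s = - inner (X x) e2" "inner (X x) (tproj S x x) = 0"
proof -
  obtain U f u where c: "chart S U f" "u \<in> U" "x = f u"
    using surface x unfolding embedded_surface_def by blast
  have U: "open U" using c by (simp add: chart_def smooth_on_def)
  have fr': "frame S (f u) e1 e2" using fr c(3) by simp
  have up: "unitary_pair e1 e2" using fr by (simp add: frame_def)
  note i = unitary_pair_inner[OF up]
  have "e1 \<in> range (chdiff f u)" "e2 \<in> range (chdiff f u)"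
    using frame_tang[OF fr] chart_tang[OF c(1,2)] c(3) by auto
  then obtain k l where e: "e1 = chdiff f u k" "e2 = chdiff f u l" by blast
  define p where "p = inner (hess f u k k) (cJ e1)"
  define q where "q = inner (hess f u k k) (cJ e2)"
  define r where "r = inner (hess f u k l) (cJ e2)"
  define s where "s = inner (hess f u l l) (cJ e2)"
  have q2: "inner (hess f u k l) (cJ e1) = q" and q3: "inner (hess f u l k) (cJ e1) = q"
    and r2: "inner (hess f u l l) (cJ e1) = r" and r3: "inner (hess f u l k) (cJ e2) = r"
    using lagrangian_hess[OF lagrangian c(1,2), of k k l] lagrangian_hess[OF lagrangian c(1,2), of l k l]
      hess_sym[OF c(1,2), of k l]
    by (simp_all add: q_def r_def e)
  have nrm: "z - tproj S x z = inner z (cJ e1) *\<^sub>R cJ e1 + inner z (cJ e2) *\<^sub>R cJ e2" for z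
    using unitary_expand[OF up, of z] tproj_frame[OF fr, of z] by (metis add.assoc add_diff_cancel_left')
  have cubic: "cubic_form x e1 e2 p q r s"
    unfolding cubic_form_def
  proof (intro allI impI)
    fix Z Z' :: "C2 \<Rightarrow> C2" assume "(Z has_derivative Z') (at x within S)"
    then have Z: "(Z has_derivative Z') (at (f u) within S)" by (simp add: c(3))
    obtain D where D: "((\<lambda>y. tproj S y (Z y)) has_derivative D) (at (f u) within S)"
      "\<And>h. inner (D (chdiff f u h)) e1 = inner (Z' (chdiff f u h)) e1 + inner (Z (f u) - tproj S (f u) (Z (f u))) (hess f u h k)"
      "\<And>h. inner (D (chdiff f u h)) e2 = inner (Z' (chdiff f u h)) e2 + inner (Z (f u) - tproj S (f u) (Z (f u))) (hess f u h l)"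
      "\<And>h. inner (D (chdiff f u h)) (cJ e1) = inner (Z (f u)) e1 * inner (hess f u h k) (cJ e1) + inner (Z (f u)) e2 * inner (hess f u h l) (cJ e1)"
      "\<And>h. inner (D (chdiff f u h)) (cJ e2) = inner (Z (f u)) e1 * inner (hess f u h k) (cJ e2) + inner (Z (f u)) e2 * inner (hess f u h l) (cJ e2)"
      using tproj_has_derivative[OF c(1,2) lagrangian fr' e Z] by blast
    note D' = D(2-5)[of k, folded e c(3)] D(2-5)[of l, folded e c(3)]
    have pqrs: "inner (cJ e1) (hess f u k k) = p" "inner (cJ e2) (hess f u k k) = q"
      "inner (cJ e1) (hess f u k l) = q" "inner (cJ e2) (hess f u k l) = r"
      "inner (cJ e1) (hess f u l k) = q" "inner (cJ e2) (hess f u l k) = r"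
      "inner (cJ e1) (hess f u l l) = r" "inner (cJ e2) (hess f u l l) = s"
      using q2 q3 r2 r3 by (simp_all add: p_def q_def r_def s_def inner_commute)
    show "\<exists>D. ((\<lambda>y. tproj S y (Z y)) has_derivative D) (at x within S) \<and>
        inner (D e1) e1 = inner (Z' e1) e1 + p * inner (Z x) (cJ e1) + q * inner (Z x) (cJ e2) \<and>
        inner (D e1) e2 = inner (Z' e1) e2 + q * inner (Z x) (cJ e1) + r * inner (Z x) (cJ e2) \<and>
        inner (D e1) (cJ e1) = p * inner (Z x) e1 + q * inner (Z x) e2 \<and>
        inner (D e1) (cJ e2) = q * inner (Z x) e1 + r * inner (Z x) e2 \<and>
        inner (D e2) e1 = inner (Z' e2) e1 + q * inner (Z x) (cJ e1) + r * inner (Z x) (cJ e2) \<and>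
        inner (D e2) e2 = inner (Z' e2) e2 + r * inner (Z x) (cJ e1) + s * inner (Z x) (cJ e2) \<and>
        inner (D e2) (cJ e1) = q * inner (Z x) e1 + r * inner (Z x) e2 \<and>
        inner (D e2) (cJ e2) = r * inner (Z x) e1 + s * inner (Z x) e2"
      by (rule exI[of _ D])
        (simp add: D' nrm inner_add_left pqrs q2 q3 r2 r3 p_def[symmetric] q_def[symmetric]
          r_def[symmetric] s_def[symmetric] D(1)[folded c(3)])
  qed
  have t: "tproj S x x = inner x e1 *\<^sub>R e1 + inner x e2 *\<^sub>R e2" by (rule tproj_frame[OF fr])
  have Xe: "inner (X x) e1 = inner x (cJ e1)" "inner (X x) e2 = inner x (cJ e2)"
    by (simp_all add: X_def cJ_inner_left nrm inner_add_left inner_add_right i del: cJ_linear)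
  \<comment> \<open>Turns the coordinate traces in \<open>meancurv\<close> and
    \<open>surf_div\<close> into sums over the orthonormal frame.\<close>
  have tr: "(\<Sum>i\<in>UNIV. \<Sum>j\<in>UNIV. ginv f u i j * b i j) =
     (fst k * fst k * b True True + fst k * snd k * b True False + snd k * fst k * b False True + snd k * snd k * b False False)
   + (fst l * fst l * b True True + fst l * snd l * b True False + snd l * fst l * b False True + snd l * snd l * b False False)"
    for b
    using ginv_trace[of f u k l b] up e by (simp add: UNIV_bool)
  have mc: "meancurv f v = - (f v - tproj S (f v) (f v))" if "v \<in> U" for v
    using shrinker c(1) that tanproj_eq_tproj[OF c(1) that] by (simp add: self_shrinker_def nproj_def)
  have normal_e: "inner (nproj f u z) (cJ w) = inner z (cJ w)" if "w \<in> {e1, e2}" for z w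
    using that tproj_frame[OF fr, of z]
    by (auto simp: nproj_def tanproj_eq_tproj[OF c(1,2)] c(3)[symmetric] inner_diff_left inner_add_left i)
  have H: "- inner (X x) w = inner (hess f u k k) (cJ w) + inner (hess f u l l) (cJ w)" if w: "w \<in> {e1, e2}" for w
  proof -
    have "- inner (X x) w = inner (meancurv f u) (cJ w)"
      using mc[OF c(2)] w by (auto simp: c(3)[symmetric] nrm inner_add_left inner_diff_left i Xe)
    also have "\<dots> = (\<Sum>i\<in>UNIV. \<Sum>j\<in>UNIV. ginv f u i j * inner (pd i (pd j f) u) (cJ w))"
      unfolding meancurv_def by (simp add: inner_sum_left normal_e[OF w])
    also have "\<dots> = inner (hess f u k k) (cJ w) + inner (hess f u l l) (cJ w)"
      unfolding tr by (simp add: hess_def chdiff_def inner_add_left algebra_simps)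
    finally show ?thesis .
  qed
  have pr: "p + r = - inner (X x) e1" using H[of e1] r2 by (simp add: p_def)
  have qs: "q + s = - inner (X x) e2" using H[of e2] by (simp add: q_def s_def)
  obtain D where D: "((\<lambda>y. tproj S y y) has_derivative D) (at x within S)"
    "inner (D e1) (cJ e1) = p * inner x e1 + q * inner x e2"
    "inner (D e2) (cJ e2) = r * inner x e1 + s * inner x e2"
    using cubic[unfolded cubic_form_def, rule_format, OF has_derivative_ident] by blast
  define X' where "X' v = - cJ (v - D v)" for v
  have X': "(X has_derivative X') (at x within S)"
    unfolding X_def[abs_def] X'_def
    by (intro has_derivative_minus bounded_linear.has_derivative[OF bounded_linear_cJ] has_derivative_diff has_derivative_ident D(1))
  note linX = has_derivative_linear[OF X']
  have fU: "f ` U \<subseteq> S" using c(1) by (simp add: chart_def)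
  \<comment> \<open>\<open>surf_div\<close> uses coordinate derivatives of
    \<open>cJ (meancurv f v)\<close>; on \<open>U\<close> this field is \<open>X\<close> composed
    with the chart, so the chain rule yields them from \<open>X'\<close>.\<close>
  have "((\<lambda>v. X (f v)) has_derivative (\<lambda>h. X' (chdiff f u h))) (at u within U)"
    by (rule has_derivative_in_compose[OF has_derivative_at_withinI[OF chart_has_derivative(1)[OF c(1,2)]]])
      (rule has_derivative_subset[OF X'[unfolded c(3)] fU])
  then have "((\<lambda>v. X (f v)) has_derivative (\<lambda>h. X' (chdiff f u h))) (at u)"
    using at_within_open[OF c(2) U] by simp
  then have "((\<lambda>v. cJ (meancurv f v)) has_derivative (\<lambda>h. X' (chdiff f u h))) (at u)"
    by (rule has_derivative_transform_within_open[OF _ U c(2)]) (simp add: mc X_def)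
  then have pdX: "pd i (\<lambda>v. cJ (meancurv f v)) u = X' (pd i f u)" for i
    using has_derivative_pd chdiff_dir by metis
  have "0 = surf_div f (\<lambda>v. cJ (meancurv f v)) u"
    using stationary c by (simp add: hamiltonian_stationary_def)
  also have "\<dots> = (\<Sum>i\<in>UNIV. \<Sum>j\<in>UNIV. ginv f u i j * inner (X' (pd i f u)) (pd j f u))"
    by (simp add: surf_div_def pdX)
  also have "\<dots> = inner (X' e1) e1 + inner (X' e2) e2"
    unfolding tr e chdiff_def
    by (simp add: linear_add[OF linX] linear_cmul[OF linX] inner_add_left inner_add_right algebra_simps)
  also have "\<dots> = - (p * inner x e1 + q * inner x e2) - (r * inner x e1 + s * inner x e2)"
    by (simp add: X'_def cJ_inner_left inner_diff_left D i del: cJ_linear)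
  also have "\<dots> = - ((p + r) * inner x e1 + (q + s) * inner x e2)" by (simp add: algebra_simps)
  also have "\<dots> = inner (X x) (tproj S x x)" unfolding pr qs t by (simp add: inner_add_right)
  finally show ?thesis using that[OF cubic pr qs] by simp
qed

end

section \<open>The first integral\<close>

context hs_lagrangian_shrinker
begin

lemma position_decomposition:
  assumes x: "x \<in> S" and fr: "frame S x e1 e2"
  shows "inner (X x) e1 = inner x (cJ e1)" "inner (X x) e2 = inner x (cJ e2)"
    "X x = inner x (cJ e1) *\<^sub>R e1 + inner x (cJ e2) *\<^sub>R e2"
    "inner x x = inner (X x) (X x) + inner (tproj S x x) (tproj S x x)"
proof -
  have up: "unitary_pair e1 e2" using fr by (simp add: frame_def)
  note i = unitary_pair_inner[OF up]
  have nrm: "x - tproj S x x = inner x (cJ e1) *\<^sub>R cJ e1 + inner x (cJ e2) *\<^sub>R cJ e2"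
    using unitary_expand[OF up, of x] tproj_frame[OF fr, of x] by (metis add.assoc add_diff_cancel_left')
  then show X: "X x = inner x (cJ e1) *\<^sub>R e1 + inner x (cJ e2) *\<^sub>R e2"
    by (simp add: X_def)
  then show "inner (X x) e1 = inner x (cJ e1)" "inner (X x) e2 = inner x (cJ e2)"
    by (simp_all add: inner_add_left i)
  show "inner x x = inner (X x) (X x) + inner (tproj S x x) (tproj S x x)"
    unfolding X tproj_frame[OF fr, of x] unitary_inner_expand[OF up, of x x]
    by (simp add: inner_add_left inner_add_right i)
qed

lemma X_tang:
  assumes "x \<in> S" shows "X x \<in> tang S x"
proof -
  obtain e1 e2 where fr: "frame S x e1 e2" using frame_exists[OF surface lagrangian assms] .
  show ?thesis
    using position_decomposition(3)[OF assms fr] fr unfolding frame_def by blast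
qed

lemma X_derivative:
  assumes x: "x \<in> S" and cf: "cubic_form x e1 e2 p q r s"
  obtains D X' where "((\<lambda>y. tproj S y y) has_derivative D) (at x within S)"
    "(X has_derivative X') (at x within S)" "\<And>v. X' v = - cJ (v - D v)"
    "inner (D e1) e1 = inner e1 e1 + p * inner x (cJ e1) + q * inner x (cJ e2)"
    "inner (D e1) e2 = inner e1 e2 + q * inner x (cJ e1) + r * inner x (cJ e2)"
    "inner (D e1) (cJ e1) = p * inner x e1 + q * inner x e2"
    "inner (D e1) (cJ e2) = q * inner x e1 + r * inner x e2"
    "inner (D e2) e1 = inner e2 e1 + q * inner x (cJ e1) + r * inner x (cJ e2)"
    "inner (D e2) e2 = inner e2 e2 + r * inner x (cJ e1) + s * inner x (cJ e2)"
    "inner (D e2) (cJ e1) = q * inner x e1 + r * inner x e2"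
    "inner (D e2) (cJ e2) = r * inner x e1 + s * inner x e2"
proof -
  obtain D where D: "((\<lambda>y. tproj S y y) has_derivative D) (at x within S)"
    "inner (D e1) e1 = inner e1 e1 + p * inner x (cJ e1) + q * inner x (cJ e2)"
    "inner (D e1) e2 = inner e1 e2 + q * inner x (cJ e1) + r * inner x (cJ e2)"
    "inner (D e1) (cJ e1) = p * inner x e1 + q * inner x e2"
    "inner (D e1) (cJ e2) = q * inner x e1 + r * inner x e2"
    "inner (D e2) e1 = inner e2 e1 + q * inner x (cJ e1) + r * inner x (cJ e2)"
    "inner (D e2) e2 = inner e2 e2 + r * inner x (cJ e1) + s * inner x (cJ e2)"
    "inner (D e2) (cJ e1) = q * inner x e1 + r * inner x e2"
    "inner (D e2) (cJ e2) = r * inner x e1 + s * inner x e2"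
    using cf[unfolded cubic_form_def, rule_format, OF has_derivative_ident] by blast
  have X': "(X has_derivative (\<lambda>v. - cJ (v - D v))) (at x within S)"
    unfolding X_def[abs_def]
    by (intro has_derivative_minus bounded_linear.has_derivative[OF bounded_linear_cJ] has_derivative_diff has_derivative_ident D(1))
  show ?thesis by (rule that[OF D(1) X' refl D(2-)])
qed

lemma continuous_on_X: "continuous_on S X"
  unfolding continuous_on_eq_continuous_within
proof
  fix x assume x: "x \<in> S"
  obtain e1 e2 where fr: "frame S x e1 e2" using frame_exists[OF surface lagrangian x] .
  obtain p q r s where cf: "cubic_form x e1 e2 p q r s" using structure_equations[OF x fr] by metis
  obtain X' where "(X has_derivative X') (at x within S)" using X_derivative[OF x cf] by metis
  then show "continuous (at x within S) X" by (rule has_derivative_continuous)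
qed

text \<open>In a frame with \<open>e\<^sub>1\<close> along \<open>X\<close>, differentiating \<open>\<langle>X, x\<^sup>T\<rangle> = 0\<close> in both tangential
  directions determines the whole second fundamental form.\<close>

lemma adapted_frame:
  assumes x: "x \<in> S" and fr: "frame S x e1 e2" and X: "X x = a *\<^sub>R e1" "a > 0"
  obtains b r where "x = a *\<^sub>R cJ e1 + b *\<^sub>R e2" "tproj S x x = b *\<^sub>R e2" "r * (a\<^sup>2 + b\<^sup>2) = a * (1 - a\<^sup>2)"
    "cubic_form x e1 e2 (- a - r) 0 r 0"
proof -
  have up: "unitary_pair e1 e2" using fr by (simp add: frame_def)
  note i = unitary_pair_inner[OF up]
  obtain p q r s where cf: "cubic_form x e1 e2 p q r s" and tr: "p + r = - inner (X x) e1" "q + s = - inner (X x) e2"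
    and XT: "inner (X x) (tproj S x x) = 0"
    using structure_equations[OF x fr] by metis
  define b where "b = inner x e2"
  have c: "inner x (cJ e1) = a" "inner x (cJ e2) = 0"
    using position_decomposition(1,2)[OF x fr] X i by simp_all
  have xe1: "inner x e1 = 0"
    using XT X i unfolding tproj_frame[OF fr, of x] by (simp add: inner_add_right)
  have T: "tproj S x x = b *\<^sub>R e2" unfolding tproj_frame[OF fr, of x] by (simp add: xe1 b_def)
  have xx: "x = a *\<^sub>R cJ e1 + b *\<^sub>R e2"
    using unitary_expand[OF up, of x] by (simp add: c xe1 b_def add.commute)
  obtain D X' where D: "((\<lambda>y. tproj S y y) has_derivative D) (at x within S)"
    "(X has_derivative X') (at x within S)" "\<And>v. X' v = - cJ (v - D v)"
    "inner (D e1) e1 = 1 + p * a" "inner (D e1) (cJ e2) = r * b"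
    "inner (D e2) e1 = q * a" "inner (D e2) (cJ e2) = s * b"
    by (rule X_derivative[OF x cf]) (simp add: c xe1 i flip: b_def)
  have "((\<lambda>y. inner (X y) (tproj S y y)) has_derivative (\<lambda>v. inner (X x) (D v) + inner (X' v) (tproj S x x))) (at x within S)"
    by (rule has_derivative_inner[OF D(2,1)])
  from tang_derivative_const[OF this, of 0]
  have "inner (X x) (D v) + inner (X' v) (tproj S x x) = 0" if "v \<in> tang S x" for v
    using that structure_equations frame_exists[OF surface lagrangian] by metis
  then have z: "inner (X x) (D e1) + inner (X' e1) (tproj S x x) = 0"
    "inner (X x) (D e2) + inner (X' e2) (tproj S x x) = 0"
    using frame_tang[OF fr] by blast+
  have X'e: "inner (X' v) e2 = inner (v - D v) (cJ e2)" for v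
    unfolding D(3) by (simp add: cJ_inner_left del: cJ_linear)
  have 1: "a * (1 + p * a) - r * b * b = 0" "a * (q * a) - s * b * b = 0"
    using z by (simp_all add: X T X'e inner_diff_left i D(4-7) inner_commute[of e1 "D e1"] inner_commute[of e1 "D e2"] algebra_simps)
  \<comment> \<open>The trace relations eliminate \<open>p\<close> and \<open>s\<close>. The second
    equation in \<open>1\<close> then becomes \<open>q * (a * a + b * b) = 0\<close>, and the first
    one determines \<open>r\<close>.\<close>
  have pr: "p = - a - r" and sq: "s = - q" using tr X i by simp_all
  have "q * (a * a + b * b) = 0" using 1(2) unfolding sq by (simp add: algebra_simps)
  moreover have "a * a + b * b > 0" using X(2) by (simp add: add_pos_nonneg)
  ultimately have "q = 0" by (metis mult_eq_0_iff less_irrefl)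
  have "r * (a\<^sup>2 + b\<^sup>2) = a * (1 - a\<^sup>2)" using 1(1) unfolding pr by (simp add: algebra_simps power2_eq_square)
  then show ?thesis using that[OF xx T] cf pr sq \<open>q = 0\<close> by simp
qed

lemma adapted_derivative:
  assumes x: "x \<in> S" and fr: "frame S x e1 e2" and X: "X x = a *\<^sub>R e1" "a > 0"
    and b: "x = a *\<^sub>R cJ e1 + b *\<^sub>R e2" and cf: "cubic_form x e1 e2 (- a - r) 0 r 0"
  obtains X' where "(X has_derivative X') (at x within S)"
    "X' e1 = ((- a - r) * a) *\<^sub>R cJ e1 - (r * b) *\<^sub>R e2" "X' e2 = (r * a) *\<^sub>R cJ e2 - (r * b) *\<^sub>R e1"
proof -
  have up: "unitary_pair e1 e2" using fr by (simp add: frame_def)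
  note i = unitary_pair_inner[OF up]
  have c: "inner x (cJ e1) = a" "inner x (cJ e2) = 0" "inner x e1 = 0" "inner x e2 = b"
    unfolding b by (simp_all add: inner_add_left i)
  obtain D X' where D: "(X has_derivative X') (at x within S)" "\<And>v. X' v = - cJ (v - D v)"
    "inner (D e1) e1 = 1 + (- a - r) * a" "inner (D e1) e2 = 0" "inner (D e1) (cJ e1) = 0" "inner (D e1) (cJ e2) = r * b"
    "inner (D e2) e1 = 0" "inner (D e2) e2 = 1 + r * a" "inner (D e2) (cJ e1) = r * b" "inner (D e2) (cJ e2) = 0"
    by (rule X_derivative[OF x cf]) (simp add: c i)
  have "X' e1 = - cJ (e1 - ((1 + (- a - r) * a) *\<^sub>R e1 + (r * b) *\<^sub>R cJ e2))"
    using unitary_expand[OF up, of "D e1"] unfolding D(2) by (simp add: D)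
  moreover have "X' e2 = - cJ (e2 - ((1 + r * a) *\<^sub>R e2 + (r * b) *\<^sub>R cJ e1))"
    using unitary_expand[OF up, of "D e2"] unfolding D(2) by (simp add: D)
  moreover have "- cJ (e1 - ((1 + (- a - r) * a) *\<^sub>R e1 + (r * b) *\<^sub>R cJ e2))
      = ((- a - r) * a) *\<^sub>R cJ e1 - (r * b) *\<^sub>R e2"
    "- cJ (e2 - ((1 + r * a) *\<^sub>R e2 + (r * b) *\<^sub>R cJ e1)) = (r * a) *\<^sub>R cJ e2 - (r * b) *\<^sub>R e1"
    by (simp_all add: algebra_simps)
  ultimately show ?thesis using that[OF D(1)] by metis
qed

lemma adapted_frame_exists:
  assumes x: "x \<in> S" and "X x \<noteq> 0"
  obtains e1 e2 a where "frame S x e1 e2" "X x = a *\<^sub>R e1" "a > 0" "a\<^sup>2 = inner (X x) (X x)"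
proof -
  define a where "a = norm (X x)"
  have a: "a > 0" using assms by (simp add: a_def)
  have "(1 / a) *\<^sub>R X x \<in> tang S x"
    by (intro subspace_scale embedded_surface_tang[OF surface x] X_tang x)
  moreover have "inner ((1 / a) *\<^sub>R X x) ((1 / a) *\<^sub>R X x) = 1"
    using a by (simp add: a_def dot_square_norm power2_eq_square)
  ultimately obtain e2 where "frame S x ((1 / a) *\<^sub>R X x) e2"
    by (rule frame_extend[OF surface lagrangian x])
  then show ?thesis using a by (intro that[of _ e2 a]) (auto simp: a_def dot_square_norm)
qed

text \<open>Write A for the squared length of \<open>X\<close> and R for that of the position. Both
  are stationary along \<open>e1\<close>. Along \<open>e2\<close> their derivatives are
  \<open>- 2 * a * r * b\<close> and \<open>2 * b\<close>, so the formula for \<open>r\<close> gives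
  the separable equation dA/dR = - A (1 - A) / R, whose integral is (1 - A) / (A R).\<close>

lemma first_integral_derivative:
  assumes x: "x \<in> S" and nz: "X x \<noteq> 0"
  shows "\<exists>L. ((\<lambda>y. (1 - inner (X y) (X y)) / (inner (X y) (X y) * inner y y)) has_derivative L) (at x within S)
    \<and> (\<forall>v\<in>tang S x. L v = 0)"
proof -
  obtain e1 e2 a where fr: "frame S x e1 e2" and a: "X x = a *\<^sub>R e1" "a > 0" "a\<^sup>2 = inner (X x) (X x)"
    using adapted_frame_exists[OF x nz] .
  have up: "unitary_pair e1 e2" using fr by (simp add: frame_def)
  note i = unitary_pair_inner[OF up]
  obtain b r where b: "x = a *\<^sub>R cJ e1 + b *\<^sub>R e2" and r: "r * (a\<^sup>2 + b\<^sup>2) = a * (1 - a\<^sup>2)"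
    and cf: "cubic_form x e1 e2 (- a - r) 0 r 0"
    using adapted_frame[OF x fr a(1,2)] by metis
  obtain X' where X': "(X has_derivative X') (at x within S)"
    "X' e1 = ((- a - r) * a) *\<^sub>R cJ e1 - (r * b) *\<^sub>R e2" "X' e2 = (r * a) *\<^sub>R cJ e2 - (r * b) *\<^sub>R e1"
    using adapted_derivative[OF x fr a(1,2) b cf] by metis
  have R: "inner x x = a\<^sup>2 + b\<^sup>2" unfolding b by (simp add: inner_add_left inner_add_right i power2_eq_square)
  then have nz': "inner (X x) (X x) * inner x x \<noteq> 0"
    unfolding R a(3)[symmetric] using a(2) by (simp add: add_pos_nonneg less_imp_neq[symmetric])
  define dA where "dA v = inner (X x) (X' v) + inner (X' v) (X x)" for v
  define dR where "dR v = inner x v + inner v x" for v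
  have dA: "((\<lambda>y. inner (X y) (X y)) has_derivative dA) (at x within S)"
    unfolding dA_def by (rule has_derivative_inner[OF X'(1) X'(1)])
  have dR: "((\<lambda>y. inner y y) has_derivative dR) (at x within S)"
    unfolding dR_def by (rule has_derivative_inner[OF has_derivative_ident has_derivative_ident])
  define L where "L v = (- (1 - a\<^sup>2) * (a\<^sup>2 * dR v + dA v * (a\<^sup>2 + b\<^sup>2)) + - dA v * (a\<^sup>2 * (a\<^sup>2 + b\<^sup>2))) / (a\<^sup>2 * (a\<^sup>2 + b\<^sup>2))\<^sup>2" for v
  have L: "((\<lambda>y. (1 - inner (X y) (X y)) / (inner (X y) (X y) * inner y y)) has_derivative L) (at x within S)"
    by (rule derivative_eq_intros dA dR refl nz')+
      (use nz' in \<open>simp add: L_def fun_eq_iff R flip: a(3), simp add: field_simps power2_eq_square\<close>)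
  have e: "dA e1 = 0" "dR e1 = 0" "dA e2 = - 2 * a * r * b" "dR e2 = 2 * b"
    unfolding dA_def dR_def a(1) X'(2,3)
    by (simp_all add: inner_diff_left inner_diff_right i) (simp_all add: b inner_add_left inner_add_right i)
  have "L e1 = 0" by (simp add: L_def e)
  moreover have "L e2 = 0"
  proof -
    have "- (1 - a\<^sup>2) * (a\<^sup>2 * dR e2 + dA e2 * (a\<^sup>2 + b\<^sup>2)) + - dA e2 * (a\<^sup>2 * (a\<^sup>2 + b\<^sup>2)) = 0"
      unfolding e using r by algebra
    then show ?thesis by (simp add: L_def)
  qed
  ultimately have "L v = 0" if "v \<in> tang S x" for v
  proof -
    obtain c d where "v = c *\<^sub>R e1 + d *\<^sub>R e2" using \<open>v \<in> tang S x\<close> fr unfolding frame_def by blast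
    then have "L v = c *\<^sub>R L e1 + d *\<^sub>R L e2"
      by (simp only: linear_add[OF has_derivative_linear[OF L]] linear_cmul[OF has_derivative_linear[OF L]])
    then show ?thesis using \<open>L e1 = 0\<close> \<open>L e2 = 0\<close> by simp
  qed
  then show ?thesis using L by blast
qed

end

section \<open>From local to global constancy\<close>

lemma locally_constant_on_surface:
  assumes S: "embedded_surface S" and x: "x \<in> S" and W: "openin (top_of_set S) W" "x \<in> W"
    and \<phi>: "\<And>y. y \<in> W \<Longrightarrow> \<exists>L. (\<phi> has_derivative L) (at y within S) \<and> (\<forall>v\<in>tang S y. L v = 0)"
  shows "\<exists>W'. openin (top_of_set S) W' \<and> x \<in> W' \<and> W' \<subseteq> W \<and> (\<forall>y\<in>W'. \<phi> y = \<phi> x)"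
proof -
  obtain U f u where c: "chart S U f" "u \<in> U" "x = f u"
    using S x unfolding embedded_surface_def by blast
  have U: "open U" and fU: "f ` U \<subseteq> S" and oU: "openin (top_of_set S) (f ` U)"
    using c by (auto simp: chart_def smooth_on_def)
  obtain g where g: "homeomorphism U (f ` U) f g" using c by (auto simp: chart_def)
  have cf: "continuous_on U f" using g by (simp add: homeomorphism_def)
  obtain O' where O': "open O'" "W = S \<inter> O'" using W by (auto simp: openin_open)
  have "open (U \<inter> f -` O')" using continuous_open_preimage[OF cf U O'(1)] .
  moreover have "u \<in> U \<inter> f -` O'" using c W O' by auto
  ultimately obtain e where e: "e > 0" "ball u e \<subseteq> U \<inter> f -` O'" using openE by blast
  have const: "\<phi> (f v) = \<phi> (f u)" if v: "v \<in> ball u e" for v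
  proof -
    have "((\<lambda>v. \<phi> (f v)) has_derivative (\<lambda>_. 0)) (at v within ball u e)" if "v \<in> ball u e" for v
    proof -
      have vU: "v \<in> U" using that e by blast
      then have "f v \<in> W" using that e O' fU by blast
      then obtain L where L: "(\<phi> has_derivative L) (at (f v) within S)" "\<forall>w\<in>tang S (f v). L w = 0"
        using \<phi> by blast
      have "((\<lambda>v. \<phi> (f v)) has_derivative (\<lambda>h. L (chdiff f v h))) (at v within ball u e)"
        by (rule has_derivative_in_compose[OF has_derivative_at_withinI[OF chart_has_derivative(1)[OF c(1) vU]]])
          (rule has_derivative_subset[OF L(1)], use e fU in blast)
      moreover have "L (chdiff f v h) = 0" for h using L(2) chart_tang[OF c(1) vU] by blast
      ultimately show ?thesis by simp
    qed
    then show ?thesis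
      using has_derivative_zero_unique[of "ball u e" "\<lambda>v. \<phi> (f v)" v u] v e by simp
  qed
  have "openin (top_of_set U) (ball u e)" using e U by (simp add: openin_open_eq)
  then have "openin (top_of_set (f ` U)) (f ` ball u e)" by (rule homeomorphism_imp_open_map[OF g])
  then have "openin (top_of_set S) (f ` ball u e)" using openin_trans oU by blast
  moreover have "x \<in> f ` ball u e" using c(3) e(1) by auto
  moreover have "f ` ball u e \<subseteq> W" using e O' fU by auto
  moreover have "\<phi> y = \<phi> x" if "y \<in> f ` ball u e" for y using that const c(3) by auto
  ultimately show ?thesis by blast
qed

locale compact_shrinker = hs_lagrangian_shrinker +
  assumes cpt: "compact S" and conn: "connected S" and ne: "S \<noteq> {}"
begin

lemma X_le: "x \<in> S \<Longrightarrow> inner (X x) (X x) \<le> inner x x"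
  using position_decomposition(4) frame_exists[OF surface lagrangian] by (metis inner_ge_zero le_add_same_cancel1)

lemma tproj_eq_0_iff: "x \<in> S \<Longrightarrow> tproj S x x = 0 \<longleftrightarrow> inner (X x) (X x) = inner x x"
  using position_decomposition(4) frame_exists[OF surface lagrangian] by (metis add_cancel_left_right inner_eq_zero_iff)

text \<open>At a maximum of the squared distance from the origin the position is orthogonal to the
  tangent plane. The maximum is positive, for otherwise \<open>S\<close> would be the single point
  0, which has no nonzero tangent vector.\<close>

lemma farthest_point:
  obtains x0 where "x0 \<in> S" "\<And>y. y \<in> S \<Longrightarrow> inner y y \<le> inner x0 x0" "inner x0 x0 > 0" "tproj S x0 x0 = 0"
proof -
  obtain x0 where x0: "x0 \<in> S" "\<And>y. y \<in> S \<Longrightarrow> inner y y \<le> inner x0 x0"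
    using continuous_attains_sup[OF cpt ne continuous_on_inner[OF continuous_on_id continuous_on_id]] by blast
  obtain U f u where c: "chart S U f" "u \<in> U" "x0 = f u"
    using surface x0(1) unfolding embedded_surface_def by blast
  have U: "open U" and fU: "f ` U \<subseteq> S" using c by (auto simp: chart_def smooth_on_def)
  note d = has_derivative_inner[OF chart_has_derivative(1)[OF c(1,2)] chart_has_derivative(1)[OF c(1,2)]]
  have "(\<lambda>h. inner (f u) (chdiff f u h) + inner (chdiff f u h) (f u)) = (\<lambda>v. 0)"
    by (rule differential_zero_maxmin[OF c(2) U d]) (use x0 fU c(3) in blast)
  then have z: "inner x0 v = 0" if "v \<in> tang S x0" for v
    using that chart_tang[OF c(1,2)] c(3) by (auto simp: inner_commute dest: fun_cong)
  obtain e1 e2 where fr: "frame S x0 e1 e2" using frame_exists[OF surface lagrangian x0(1)] .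
  have T: "tproj S x0 x0 = 0"
    unfolding tproj_frame[OF fr, of x0] using z frame_tang[OF fr] by simp
  have "inner x0 x0 \<noteq> 0"
  proof
    assume "inner x0 x0 = 0"
    then have "y = 0" if "y \<in> S" for y using x0(2)[OF that] inner_ge_zero[of y] by (metis inner_eq_zero_iff order_antisym)
    then have z: "inner e1 y = 0" if "y \<in> S" for y
      unfolding \<open>\<And>y. y \<in> S \<Longrightarrow> y = 0\<close>[OF that] by simp
    have "inner e1 e1 = 0"
      by (rule tang_derivative_const[OF bounded_linear.has_derivative[OF bounded_linear_inner_right
            has_derivative_ident] z frame_tang(1)[OF fr]])
    then show False using fr by (simp add: frame_def unitary_pair_def)
  qed
  then have "inner x0 x0 > 0" using inner_ge_zero[of x0] by linarith
  then show ?thesis using that[OF x0 _ T] by blast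
qed

text \<open>At \<open>x0\<close> the lengths of \<open>X\<close> and of the position agree, so
  \<open>f0\<close> is the first integral there. Stated without division, the equation defines a
  closed set even if \<open>X\<close> had zeros; on this set \<open>X\<close> cannot vanish, so
  local constancy makes it open, and connectedness finishes.\<close>

lemma first_integral_global:
  assumes x0: "x0 \<in> S" "\<And>y. y \<in> S \<Longrightarrow> inner y y \<le> inner x0 x0" "inner x0 x0 > 0" "tproj S x0 x0 = 0"
  defines "f0 \<equiv> (1 - inner x0 x0) / (inner x0 x0)\<^sup>2"
  shows "\<And>y. y \<in> S \<Longrightarrow> inner (X y) (X y) * (1 + f0 * inner y y) = 1"
proof -
  define Q where "Q = {y \<in> S. inner (X y) (X y) * (1 + f0 * inner y y) = 1}"
  have "closedin (top_of_set S) Q"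
    unfolding Q_def by (rule continuous_closedin_preimage_constant)
      (intro continuous_on_mult continuous_on_inner continuous_on_add continuous_on_const continuous_on_X continuous_on_id)
  moreover have "openin (top_of_set S) Q"
  proof (subst openin_subopen, intro ballI)
    fix y assume y: "y \<in> Q"
    then have yS: "y \<in> S" by (simp add: Q_def)
    define A where "A z = inner (X z) (X z)" for z
    define \<phi> where "\<phi> z = (1 - A z) / (A z * inner z z)" for z
    have eq: "A z * (1 + f0 * inner z z) = 1 \<longleftrightarrow> \<phi> z = f0" if "z \<in> S" "X z \<noteq> 0" for z
    proof -
      have "A z > 0" using that(2) by (simp add: A_def)
      moreover from this have "inner z z > 0" using X_le[OF that(1)] unfolding A_def by linarith
      ultimately have "\<phi> z = f0 \<longleftrightarrow> 1 - A z = f0 * (A z * inner z z)"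
        by (simp add: \<phi>_def divide_eq_eq)
      also have "\<dots> \<longleftrightarrow> A z * (1 + f0 * inner z z) = 1" by argo
      finally show ?thesis by simp
    qed
    define N where "N = {z \<in> S. X z \<noteq> 0}"
    have "openin (top_of_set S) N"
    proof -
      have "N = S \<inter> X -` (- {0})" by (auto simp: N_def)
      then show ?thesis using continuous_openin_preimage_gen[OF continuous_on_X, of "- {0}"]
        by (simp add: open_Compl)
    qed
    moreover have "y \<in> N" using y by (auto simp: N_def Q_def)
    moreover have "\<exists>L. (\<phi> has_derivative L) (at z within S) \<and> (\<forall>v\<in>tang S z. L v = 0)" if "z \<in> N" for z
    proof -
      have "z \<in> S" "X z \<noteq> 0" using that by (simp_all add: N_def)
      then show ?thesis using first_integral_derivative[of z] unfolding \<phi>_def A_def by simp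
    qed
    ultimately obtain W' where W': "openin (top_of_set S) W'" "y \<in> W'" "W' \<subseteq> N" "\<forall>z\<in>W'. \<phi> z = \<phi> y"
      using locally_constant_on_surface[OF surface yS, of N \<phi>] by blast
    have f0: "\<phi> y = f0" using eq[OF yS] y \<open>y \<in> N\<close> by (simp add: Q_def N_def A_def)
    have "W' \<subseteq> Q"
    proof
      fix z assume z: "z \<in> W'"
      then have "z \<in> S" "X z \<noteq> 0" using W'(3) by (auto simp: N_def)
      then show "z \<in> Q" using eq[of z] bspec[OF W'(4) z] f0 by (simp add: Q_def A_def)
    qed
    then show "\<exists>T. openin (top_of_set S) T \<and> y \<in> T \<and> T \<subseteq> Q" using W' by blast
  qed
  moreover have "x0 \<in> Q"
  proof -
    have "inner (X x0) (X x0) = inner x0 x0" using tproj_eq_0_iff[OF x0(1)] x0(4) by simp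
    then show ?thesis using x0(1,3) by (simp add: Q_def f0_def field_simps power2_eq_square)
  qed
  ultimately have "Q = S" using conn[unfolded connected_clopen, rule_format, of Q] by blast
  then show "\<And>y. y \<in> S \<Longrightarrow> inner (X y) (X y) * (1 + f0 * inner y y) = 1" unfolding Q_def by blast
qed

text \<open>The point is the sign \<open>f0 < 0\<close>, after which \<open>k = - 1 / f0\<close>. If
  \<open>f0\<close> were nonnegative, then \<open>R \<le> 1\<close>, and maximality of
  \<open>R\<close> would force both squared lengths to equal \<open>R\<close> everywhere. The
  tangential part of the position would vanish identically, and the trace of its derivative would
  give \<open>inner (X x0) (X x0) = 2\<close>.\<close>

lemma first_integral:
  obtains k x0 where "k > 0" "\<And>y. y \<in> S \<Longrightarrow> inner (X y) (X y) * (k - inner y y) = k" "x0 \<in> S" "tproj S x0 x0 = 0"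
proof -
  obtain x0 where x0: "x0 \<in> S" "\<And>y. y \<in> S \<Longrightarrow> inner y y \<le> inner x0 x0" "inner x0 x0 > 0" "tproj S x0 x0 = 0"
    using farthest_point by blast
  define R where "R = inner x0 x0"
  define f0 where "f0 = (1 - R) / R\<^sup>2"
  have A: "inner (X y) (X y) * (1 + f0 * inner y y) = 1" if "y \<in> S" for y
    using first_integral_global[OF x0 that] by (simp add: f0_def R_def)
  have "f0 < 0"
  proof (rule ccontr)
    assume "\<not> f0 < 0"
    then have f0: "f0 \<ge> 0" by simp
    then have R1: "R \<le> 1" using x0(3) by (auto simp: f0_def R_def zero_le_divide_iff)
    have eq: "inner (X y) (X y) = R \<and> inner y y = R" if y: "y \<in> S" for y
    proof -
      have yR: "inner y y \<le> R" using x0(2)[OF y] by (simp add: R_def)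
      have "R * (1 + f0 * R) = 1" using x0(3) by (simp add: f0_def R_def field_simps power2_eq_square)
      also have "1 = inner (X y) (X y) * (1 + f0 * inner y y)" using A[OF y] by simp
      also have "\<dots> \<le> inner (X y) (X y) * (1 + f0 * R)"
        using yR f0 by (intro mult_left_mono add_left_mono) simp_all
      finally have "R * (1 + f0 * R) \<le> inner (X y) (X y) * (1 + f0 * R)" .
      moreover have "1 + f0 * R > 0" using f0 x0(3) by (simp add: R_def add_pos_nonneg)
      ultimately have "R \<le> inner (X y) (X y)" by (rule mult_right_le_imp_le)
      then show ?thesis using X_le[OF y] yR by simp
    qed
    have T: "tproj S y y = 0" if "y \<in> S" for y using eq[OF that] tproj_eq_0_iff[OF that] by simp
    obtain e1 e2 where fr: "frame S x0 e1 e2" using frame_exists[OF surface lagrangian x0(1)] .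
    have up: "unitary_pair e1 e2" using fr by (simp add: frame_def)
    note i = unitary_pair_inner[OF up]
    obtain p q r s where cf: "cubic_form x0 e1 e2 p q r s" and tr: "p + r = - inner (X x0) e1" "q + s = - inner (X x0) e2"
      using structure_equations[OF x0(1) fr] by metis
    note pd = position_decomposition[OF x0(1) fr]
    obtain D where D: "((\<lambda>y. tproj S y y) has_derivative D) (at x0 within S)"
      "inner (D e1) e1 = 1 + p * inner x0 (cJ e1) + q * inner x0 (cJ e2)"
      "inner (D e2) e2 = 1 + r * inner x0 (cJ e1) + s * inner x0 (cJ e2)"
      by (rule X_derivative[OF x0(1) cf]) (simp add: i)
    have "D e1 = 0" "D e2 = 0" using tang_derivative_const[OF D(1) T] frame_tang[OF fr] by auto
    then have "2 + (p + r) * inner x0 (cJ e1) + (q + s) * inner x0 (cJ e2) = 0"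
      using D(2,3) by (simp add: algebra_simps)
    then have "inner (X x0) (X x0) = 2"
      unfolding tr unitary_inner_expand[OF up, of "X x0" "X x0"] using pd(1,2)
      by (simp add: pd(3) inner_add_left i)
    then show False using eq[OF x0(1)] R1 by simp
  qed
  define k where "k = - 1 / f0"
  have "k > 0" using \<open>f0 < 0\<close> by (simp add: k_def)
  moreover have "inner (X y) (X y) * (k - inner y y) = k" if "y \<in> S" for y
  proof -
    have "k - inner y y = k * (1 + f0 * inner y y)" using \<open>f0 < 0\<close> by (simp add: k_def algebra_simps)
    then show ?thesis using A[OF that] by (metis mult.left_commute mult.right_neutral)
  qed
  ultimately show ?thesis using that x0 by blast
qed

end

section \<open>Orbits on the surface\<close>

lemma tang_image:
  assumes "(g has_derivative D) (at x within S)" "v \<in> tang S x"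
  shows "D v \<in> tang (g ` S) (g x)"
proof -
  obtain \<gamma> where g: "\<gamma> 0 = x" "\<forall>t\<ge>0. \<gamma> t \<in> S" "(\<gamma> has_vector_derivative v) (at 0 within {0..})"
    using assms(2) by (auto simp: tang_def)
  show ?thesis
    unfolding tang_def using tang_compose[OF assms(1) g] g by (intro CollectI exI[of _ "\<lambda>t. g (\<gamma> t)"]) auto
qed

text \<open>Multiplication by the unit complex number exp(i \<theta>), in real terms.\<close>

definition rot :: "real \<Rightarrow> C2 \<Rightarrow> C2" where
  "rot \<theta> v = cos \<theta> *\<^sub>R v + sin \<theta> *\<^sub>R cJ v"

lemma rot_has_vector_derivative [derivative_intros]:
  "((\<lambda>t. rot (c * t) v) has_vector_derivative c *\<^sub>R cJ (rot (c * t) v)) (at t within A)"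
proof -
  have "((\<lambda>t. cos (c * t) *\<^sub>R v + sin (c * t) *\<^sub>R cJ v) has_vector_derivative
     (- sin (c * t) * c) *\<^sub>R v + (cos (c * t) * c) *\<^sub>R cJ v) (at t within A)"
    by (auto intro!: derivative_eq_intros)
  moreover have "(- sin (c * t) * c) *\<^sub>R v + (cos (c * t) * c) *\<^sub>R cJ v = c *\<^sub>R cJ (rot (c * t) v)"
    by (simp add: rot_def algebra_simps)
  ultimately show ?thesis by (simp add: rot_def)
qed

locale normalized_shrinker = compact_shrinker +
  fixes k :: real
  assumes k_pos: "k > 0" and K: "\<And>y. y \<in> S \<Longrightarrow> inner (X y) (X y) * (k - inner y y) = k"
begin

lemma X_nonzero: "y \<in> S \<Longrightarrow> X y \<noteq> 0"
  using K[of y] k_pos by auto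

lemma radius_less: "y \<in> S \<Longrightarrow> inner y y < k"
  using K[of y] k_pos inner_ge_zero[of "X y"] by (metis diff_gt_0_iff_gt zero_less_mult_pos order_le_less mult_zero_left less_irrefl)

text \<open>The factor \<open>(k - |y|\<^sup>2) / k\<close> is \<open>1 / |X y|\<^sup>2\<close> for \<open>y \<in> S\<close>.\<close>

definition W :: "C2 \<Rightarrow> C2" where "W y = ((k - inner y y) / k) *\<^sub>R X y"

text \<open>By \<open>K\<close>, k (1 - a^2) = - a^2 |x|^2; inserted in the relation for
  \<open>r\<close> this cancels |x|^2 and leaves r = - a^3 / k. The second fundamental form thus
  depends on \<open>a\<close> alone.\<close>

lemma adapted_frame_k:
  assumes x: "x \<in> S" and fr: "frame S x e1 e2" and X: "X x = a *\<^sub>R e1" "a > 0"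
  obtains b X' where "x = a *\<^sub>R cJ e1 + b *\<^sub>R e2" "tproj S x x = b *\<^sub>R e2" "a * (k - inner x x) = k / a"
    "cubic_form x e1 e2 (- a + a ^ 3 / k) 0 (- (a ^ 3 / k)) 0"
    "(X has_derivative X') (at x within S)"
    "X' e1 = (- a\<^sup>2 + a ^ 4 / k) *\<^sub>R cJ e1 + (a ^ 3 * b / k) *\<^sub>R e2"
    "X' e2 = - (a ^ 4 / k) *\<^sub>R cJ e2 + (a ^ 3 * b / k) *\<^sub>R e1"
proof -
  have up: "unitary_pair e1 e2" using fr by (simp add: frame_def)
  note i = unitary_pair_inner[OF up]
  obtain b r where b: "x = a *\<^sub>R cJ e1 + b *\<^sub>R e2" "tproj S x x = b *\<^sub>R e2" and r: "r * (a\<^sup>2 + b\<^sup>2) = a * (1 - a\<^sup>2)"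
    and cf: "cubic_form x e1 e2 (- a - r) 0 r 0"
    using adapted_frame[OF x fr X] by metis
  obtain X' where X': "(X has_derivative X') (at x within S)"
    "X' e1 = ((- a - r) * a) *\<^sub>R cJ e1 - (r * b) *\<^sub>R e2" "X' e2 = (r * a) *\<^sub>R cJ e2 - (r * b) *\<^sub>R e1"
    using adapted_derivative[OF x fr X b(1) cf] by metis
  have R: "inner x x = a\<^sup>2 + b\<^sup>2" unfolding b(1) by (simp add: inner_add_left inner_add_right i power2_eq_square)
  have k1: "a\<^sup>2 * (k - inner x x) = k" using K[OF x] by (simp add: X i power2_eq_square)
  have "k * (r * (a\<^sup>2 + b\<^sup>2)) = - (a ^ 3) * (a\<^sup>2 + b\<^sup>2)"
    using r k1 unfolding R by algebra
  then have "(k * r) * (a\<^sup>2 + b\<^sup>2) = - (a ^ 3) * (a\<^sup>2 + b\<^sup>2)" by (simp only: mult.assoc)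
  moreover have "a\<^sup>2 + b\<^sup>2 > 0" using X(2) by (simp add: add_pos_nonneg)
  ultimately have "k * r = - (a ^ 3)" using mult_right_cancel[of "a\<^sup>2 + b\<^sup>2" "k * r" "- (a ^ 3)"] by linarith
  then have rk: "r = - (a ^ 3 / k)" using k_pos by (simp add: field_simps)
  have 1: "a * (k - inner x x) = k / a" using k1 X(2) by (simp add: field_simps power2_eq_square)
  have 2: "(- a - r) = - a + a ^ 3 / k" by (simp add: rk)
  have 3: "X' e1 = (- a\<^sup>2 + a ^ 4 / k) *\<^sub>R cJ e1 + (a ^ 3 * b / k) *\<^sub>R e2"
    unfolding X'(2) rk by (simp add: algebra_simps power2_eq_square power_numeral_reduce)
  have 4: "X' e2 = - (a ^ 4 / k) *\<^sub>R cJ e2 + (a ^ 3 * b / k) *\<^sub>R e1"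
    unfolding X'(3) rk by (simp add: algebra_simps power_numeral_reduce)
  show ?thesis using that[OF b 1 _ X'(1) 3 4] cf unfolding 2 rk by simp
qed

text \<open>Since \<open>W x = (1 / a) *\<^sub>R e1\<close> and the position is orthogonal to
  \<open>e1\<close>, the scalar factor of \<open>W\<close> is stationary along \<open>W\<close>.
  Only \<open>X' e1\<close> remains, and dividing it by a^3 removes every nonlinear dependence on
  \<open>a\<close>.\<close>

lemma W_derivative:
  assumes x: "x \<in> S"
  obtains W' where "(W has_derivative W') (at x within S)" "W' (W x) = (1 / k) *\<^sub>R x - cJ (W x)" "W x \<in> tang S x"
proof -
  obtain e1 e2 a where fr: "frame S x e1 e2" and a: "X x = a *\<^sub>R e1" "a > 0" "a\<^sup>2 = inner (X x) (X x)"
    using adapted_frame_exists[OF x X_nonzero[OF x]] .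
  have up: "unitary_pair e1 e2" using fr by (simp add: frame_def)
  note i = unitary_pair_inner[OF up]
  obtain b X' where b: "x = a *\<^sub>R cJ e1 + b *\<^sub>R e2" "a * (k - inner x x) = k / a"
    "(X has_derivative X') (at x within S)" "X' e1 = (- a\<^sup>2 + a ^ 4 / k) *\<^sub>R cJ e1 + (a ^ 3 * b / k) *\<^sub>R e2"
    using adapted_frame_k[OF x fr a(1,2)] by metis
  note l = has_derivative_linear[OF b(3)]
  define W' where "W' v = ((k - inner x x) / k) *\<^sub>R X' v + (- (inner x v + inner v x) / k) *\<^sub>R X x" for v
  have W': "(W has_derivative W') (at x within S)"
    unfolding W_def[abs_def] W'_def using k_pos
    by (auto intro!: derivative_eq_intros b(3))
  have kk: "(k - inner x x) / k = 1 / a\<^sup>2"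
    using b(2) a(2) k_pos by (simp add: field_simps power2_eq_square)
  have W: "W x = (1 / a) *\<^sub>R e1" unfolding W_def kk a(1) using a(2) by (simp add: power2_eq_square)
  have o: "inner x e1 = 0" unfolding b(1) by (simp add: inner_add_left i)
  have "W' (W x) = (1 / a ^ 3) *\<^sub>R X' e1"
    unfolding W'_def W kk using o a(2) by (simp add: linear_cmul[OF l] inner_commute[of e1] power_numeral_reduce)
  also have "\<dots> = (1 / a ^ 3 * (- a\<^sup>2 + a ^ 4 / k)) *\<^sub>R cJ e1 + (1 / a ^ 3 * (a ^ 3 * b / k)) *\<^sub>R e2"
    unfolding b(4) by (simp add: scaleR_add_right)
  also have "1 / a ^ 3 * (- a\<^sup>2 + a ^ 4 / k) = a / k - 1 / a"
    using a(2) k_pos by (simp add: field_simps power_numeral_reduce)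
  also have "1 / a ^ 3 * (a ^ 3 * b / k) = b / k" using a(2) by simp
  also have "(a / k - 1 / a) *\<^sub>R cJ e1 + (b / k) *\<^sub>R e2 = (1 / k) *\<^sub>R x - cJ (W x)"
    unfolding W by (subst b(1)) (simp add: algebra_simps)
  finally have "W' (W x) = (1 / k) *\<^sub>R x - cJ (W x)" .
  moreover have "W x \<in> tang S x"
    unfolding W_def by (intro subspace_scale embedded_surface_tang[OF surface x] X_tang x)
  ultimately show ?thesis using that W' by blast
qed

text \<open>An orbit of \<open>W\<close> satisfies x'' = x / k - J x'. The trial solution exp(-i
  \<lambda> t) p leads to \<lambda>^2 - \<lambda> + 1/k = 0, whose roots are \<open>\<alpha>\<close>
  and \<open>\<beta>\<close> by the hypotheses on sum and product; the condition on
  \<open>W x\<close> matches the initial velocity. Invariance is applied to the graph of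
  \<open>W\<close>, where the equation is the linear field \<open>Y\<close>.\<close>

lemma rotation_orbit:
  assumes x: "x \<in> S" "x = p + q" and Wx: "W x = - cJ (\<alpha> *\<^sub>R p + \<beta> *\<^sub>R q)"
    and ab: "\<alpha> + \<beta> = 1" "\<alpha> * \<beta> = 1 / k" and t: "t \<ge> 0"
  shows "rot (- \<alpha> * t) p + rot (- \<beta> * t) q \<in> S"
proof -
  define z where "z t = (rot (- \<alpha> * t) p + rot (- \<beta> * t) q,
     - cJ (\<alpha> *\<^sub>R rot (- \<alpha> * t) p + \<beta> *\<^sub>R rot (- \<beta> * t) q))" for t
  define Y where "Y y = (snd y, (1 / k) *\<^sub>R fst y - cJ (snd y))" for y :: "C2 \<times> C2"
  define G where "G = (\<lambda>y. (y, W y)) ` S"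
  have "z t \<in> G"
  proof (rule tangent_linear_flow_invariant[where Y = Y])
    have "continuous_on S W"
      unfolding continuous_on_eq_continuous_within using W_derivative has_derivative_continuous by metis
    then show "compact G" unfolding G_def by (intro compact_continuous_image continuous_intros cpt)
    show "bounded_linear Y"
      unfolding Y_def
      by (intro bounded_linear_Pair bounded_linear_snd bounded_linear_sub bounded_linear_compose[OF bounded_linear_cJ]
          bounded_linear_const_scaleR bounded_linear_fst)
    show "Y y \<in> tang G y" if "y \<in> G" for y
    proof -
      obtain w where w: "w \<in> S" "y = (w, W w)" using \<open>y \<in> G\<close> unfolding G_def by blast
      obtain W' where W': "(W has_derivative W') (at w within S)" "W' (W w) = (1 / k) *\<^sub>R w - cJ (W w)" "W w \<in> tang S w"
        using W_derivative[OF w(1)] .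
      have "((\<lambda>y. (y, W y)) has_derivative (\<lambda>v. (v, W' v))) (at w within S)"
        by (intro has_derivative_Pair has_derivative_ident W')
      from tang_image[OF this W'(3)] show ?thesis by (simp add: G_def w Y_def W')
    qed
    show "(z has_vector_derivative Y (z t)) (at t)" for t
    proof -
      have a2: "\<alpha> * \<alpha> = \<alpha> - 1 / k" "\<beta> * \<beta> = \<beta> - 1 / k"
        unfolding ab(2)[symmetric] using ab(1) by algebra+
      define P Q where "P = rot (- \<alpha> * t) p" and "Q = rot (- \<beta> * t) q"
      have 1: "((\<lambda>t. rot (- \<alpha> * t) p) has_vector_derivative (- \<alpha>) *\<^sub>R cJ P) (at t)"
        "((\<lambda>t. rot (- \<beta> * t) q) has_vector_derivative (- \<beta>) *\<^sub>R cJ Q) (at t)"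
        unfolding P_def Q_def by (rule rot_has_vector_derivative)+
      have 2: "((\<lambda>t. - cJ (\<alpha> *\<^sub>R rot (- \<alpha> * t) p + \<beta> *\<^sub>R rot (- \<beta> * t) q)) has_vector_derivative
         - cJ (\<alpha> *\<^sub>R (- \<alpha>) *\<^sub>R cJ P + \<beta> *\<^sub>R (- \<beta>) *\<^sub>R cJ Q)) (at t)"
        by (intro has_vector_derivative_minus bounded_linear.has_vector_derivative[OF bounded_linear_cJ]
            has_vector_derivative_add bounded_linear.has_vector_derivative[OF bounded_linear_scaleR_right] 1)
      have "(z has_vector_derivative ((- \<alpha>) *\<^sub>R cJ P + (- \<beta>) *\<^sub>R cJ Q,
          - cJ (\<alpha> *\<^sub>R (- \<alpha>) *\<^sub>R cJ P + \<beta> *\<^sub>R (- \<beta>) *\<^sub>R cJ Q))) (at t)"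
        unfolding z_def by (intro has_vector_derivative_Pair has_vector_derivative_add 1 2)
      moreover have "((- \<alpha>) *\<^sub>R cJ P + (- \<beta>) *\<^sub>R cJ Q, - cJ (\<alpha> *\<^sub>R (- \<alpha>) *\<^sub>R cJ P + \<beta> *\<^sub>R (- \<beta>) *\<^sub>R cJ Q)) = Y (z t)"
        unfolding Y_def z_def P_def[symmetric] Q_def[symmetric]
        by (simp add: a2 algebra_simps)
      ultimately show ?thesis by simp
    qed
    show "z 0 \<in> G" using x Wx by (auto simp: z_def G_def rot_def)
  qed (rule t)
  then show ?thesis by (auto simp: z_def G_def)
qed

end

section \<open>The orthogonal field and its great circles\<close>

context normalized_shrinker
begin

text \<open>Over each point there are exactly two vectors, the two signs of the field
  \<open>V\<close>; keeping both avoids a global choice of sign.\<close>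

definition frame_bundle :: "(C2 \<times> C2) set" where
  "frame_bundle = {(x, v). x \<in> S \<and> v \<in> tang S x \<and> inner v (X x) = 0 \<and> inner v v = k - inner x x}"

lemma tproj_tang_iff:
  assumes "x \<in> S" shows "v \<in> tang S x \<longleftrightarrow> tproj S x v = v"
proof -
  obtain e1 e2 where fr: "frame S x e1 e2" using frame_exists[OF surface lagrangian assms] .
  show ?thesis using tang_frame_iff[OF fr, of v] tproj_frame[OF fr, of v] by metis
qed

lemma tproj_in_tang: assumes "x \<in> S" shows "tproj S x v \<in> tang S x"
proof -
  obtain e1 e2 where fr: "frame S x e1 e2" using frame_exists[OF surface lagrangian assms] .
  show ?thesis unfolding tproj_frame[OF fr, of v] using fr unfolding frame_def by blast
qed

lemma linear_tproj: assumes "x \<in> S" shows "linear (tproj S x)"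
proof -
  obtain e1 e2 where fr: "frame S x e1 e2" using frame_exists[OF surface lagrangian assms] .
  show ?thesis
    by (rule linearI) (simp_all add: tproj_frame[OF fr] inner_add_left algebra_simps)
qed

lemma tproj_const_derivative:
  assumes x: "x \<in> S"
  shows "\<exists>D. ((\<lambda>y. tproj S y z) has_derivative D) (at x within S)"
proof -
  obtain e1 e2 where fr: "frame S x e1 e2" using frame_exists[OF surface lagrangian x] .
  obtain p q r s where cf: "cubic_form x e1 e2 p q r s" using structure_equations[OF x fr] by metis
  show ?thesis using cf[unfolded cubic_form_def, rule_format, OF has_derivative_const[of z]] by blast
qed

lemma compact_frame_bundle: "compact frame_bundle"
proof -
  \<comment> \<open>The conditions on a pair become one equation for \<open>g\<close>. Tangency is
    written as invariance under the projection, expanded in a fixed basis so that continuity is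
    needed only for projections of constant vectors.\<close>
  define g where "g p = ((\<Sum>b\<in>Basis. inner (snd p) b *\<^sub>R tproj S (fst p) b) - snd p,
     (inner (snd p) (X (fst p)), inner (snd p) (snd p) + inner (fst p) (fst p)))" for p :: "C2 \<times> C2"
  have expand: "(\<Sum>b\<in>Basis. inner v b *\<^sub>R tproj S x b) = tproj S x v" if "x \<in> S" for x v
    using linear_sum[OF linear_tproj[OF that], of "\<lambda>b. inner v b *\<^sub>R b" Basis]
    by (simp add: linear_cmul[OF linear_tproj[OF that]] euclidean_representation)
  define C where "C = S \<times> (cball 0 (sqrt k) :: C2 set)"
  have C: "compact C" unfolding C_def by (intro compact_Times cpt compact_cball)
  have "continuous_on S (\<lambda>y. tproj S y z)" for z
    unfolding continuous_on_eq_continuous_within using tproj_const_derivative has_derivative_continuous by metis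
  then have 1: "continuous_on C (\<lambda>p. tproj S (fst p) z)" for z
    by (rule continuous_on_compose2) (auto simp: C_def intro: continuous_on_fst)
  have 2: "continuous_on C (\<lambda>p. X (fst p))"
    by (rule continuous_on_compose2[OF continuous_on_X]) (auto simp: C_def intro: continuous_on_fst)
  have "continuous_on C g"
    unfolding g_def
    by (intro continuous_on_Pair continuous_on_diff continuous_on_sum continuous_on_scaleR continuous_on_inner
        continuous_on_add 1 2 continuous_on_snd continuous_on_fst continuous_on_id continuous_on_const)
  then have "closed {p \<in> C. g p = (0, (0, k))}"
    by (rule continuous_closed_preimage_constant) (use C compact_imp_closed in blast)
  moreover have "frame_bundle = {p \<in> C. g p = (0, (0, k))}"
  proof -
    have "norm v \<le> sqrt k" if "inner v v = k - inner x x" for v x :: C2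
      using that by (simp add: norm_eq_sqrt_inner)
    then show ?thesis
      by (auto simp: frame_bundle_def C_def g_def expand tproj_tang_iff simp del: inner_Pair)
  qed
  ultimately show ?thesis
    using C by (metis (no_types, lifting) closed_Int_compact compact_Int_closed inf.absorb_iff2 mem_Collect_eq subsetI)
qed

lemma frame_bundle_frame:
  assumes "(x, v) \<in> frame_bundle"
  obtains e1 e2 a \<mu> where "frame S x e1 e2" "X x = a *\<^sub>R e1" "a > 0" "v = \<mu> *\<^sub>R e2" "\<mu> > 0" "\<mu>\<^sup>2 = k - inner x x"
proof -
  have x: "x \<in> S" and v: "v \<in> tang S x" "inner v (X x) = 0" "inner v v = k - inner x x"
    using assms by (auto simp: frame_bundle_def)
  note sub = embedded_surface_tang(1)[OF surface x]
  define a where "a = norm (X x)"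
  define \<mu> where "\<mu> = norm v"
  have a: "a > 0" using X_nonzero[OF x] by (simp add: a_def)
  have \<mu>2: "\<mu>\<^sup>2 = k - inner x x" using v(3) by (simp add: \<mu>_def dot_square_norm)
  have "v \<noteq> 0" using v(3) radius_less[OF x] by auto
  then have \<mu>: "\<mu> > 0" by (simp add: \<mu>_def)
  have "frame S x ((1 / a) *\<^sub>R X x) ((1 / \<mu>) *\<^sub>R v)"
  proof (rule frameI[OF surface lagrangian x])
    show "(1 / a) *\<^sub>R X x \<in> tang S x" "(1 / \<mu>) *\<^sub>R v \<in> tang S x"
      by (intro subspace_scale sub X_tang x v)+
    show "inner ((1 / a) *\<^sub>R X x) ((1 / a) *\<^sub>R X x) = 1" using a by (simp add: a_def dot_square_norm power2_eq_square)
    show "inner ((1 / \<mu>) *\<^sub>R v) ((1 / \<mu>) *\<^sub>R v) = 1" using \<mu> by (simp add: \<mu>_def dot_square_norm power2_eq_square)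
    show "inner ((1 / a) *\<^sub>R X x) ((1 / \<mu>) *\<^sub>R v) = 0" using v(2) by (simp add: inner_commute)
  qed
  then show ?thesis using a \<mu> \<mu>2 by (intro that[of _ _ a \<mu>]) auto
qed

text \<open>The tangential part of the position is its component along \<open>v\<close>, and
  \<open>v\<close> has squared length \<open>k - inner x x\<close>. The scalar factor of
  \<open>W\<close> cancels this denominator, so \<open>W\<close> becomes a polynomial in
  \<open>x\<close> and \<open>v\<close>, which is explicit along a great circle.\<close>

lemma W_formula:
  assumes F: "(x, v) \<in> frame_bundle"
  shows "W x = - cJ (((k - inner x x) / k) *\<^sub>R x - (inner x v / k) *\<^sub>R v)"
proof -
  have x: "x \<in> S" using F by (simp add: frame_bundle_def)
  obtain e1 e2 a \<mu> where fr: "frame S x e1 e2" and a: "X x = a *\<^sub>R e1" "a > 0"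
    and \<mu>: "v = \<mu> *\<^sub>R e2" "\<mu> > 0" "\<mu>\<^sup>2 = k - inner x x"
    using frame_bundle_frame[OF F] .
  have up: "unitary_pair e1 e2" using fr by (simp add: frame_def)
  note i = unitary_pair_inner[OF up]
  obtain b where b: "x = a *\<^sub>R cJ e1 + b *\<^sub>R e2"
    using adapted_frame_k[OF x fr a] by metis
  have "inner x v = b * \<mu>" unfolding \<mu>(1) by (subst b) (simp add: inner_add_left i)
  then have 1: "(inner x v / k) *\<^sub>R v = ((k - inner x x) / k) *\<^sub>R (b *\<^sub>R e2)"
    unfolding \<mu>(3)[symmetric] by (simp add: \<mu>(1) power2_eq_square)
  have "x - b *\<^sub>R e2 = a *\<^sub>R cJ e1" by (subst b) simp
  then have "- cJ (((k - inner x x) / k) *\<^sub>R x - (inner x v / k) *\<^sub>R v) = - cJ (((k - inner x x) / k) *\<^sub>R (a *\<^sub>R cJ e1))"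
    unfolding 1 by (simp only: scaleR_diff_right[symmetric])
  also have "\<dots> = W x" by (simp add: W_def a(1))
  finally show ?thesis by simp
qed

text \<open>A local section \<open>V\<close> through \<open>(x, v)\<close> is differentiated along
  \<open>v\<close>. The component of \<open>V' v\<close> along \<open>e1\<close> comes from
  orthogonality to \<open>X\<close>, the one along \<open>e2\<close> from the prescribed length, and
  the normal ones from the cubic form applied to \<open>V\<close>; together they are the components
  of \<open>- x\<close>.\<close>

lemma frame_bundle_tang:
  assumes F: "(x, v) \<in> frame_bundle"
  shows "(v, - x) \<in> tang frame_bundle (x, v)"
proof -
  have x: "x \<in> S" and v: "v \<in> tang S x" "inner v (X x) = 0" "inner v v = k - inner x x"
    using F by (auto simp: frame_bundle_def)
  obtain e1 e2 a \<mu> where fr: "frame S x e1 e2" and a: "X x = a *\<^sub>R e1" "a > 0"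
    and \<mu>: "v = \<mu> *\<^sub>R e2" "\<mu> > 0" "\<mu>\<^sup>2 = k - inner x x"
    using frame_bundle_frame[OF F] .
  have up: "unitary_pair e1 e2" using fr by (simp add: frame_def)
  note i = unitary_pair_inner[OF up]
  obtain b X' where b: "x = a *\<^sub>R cJ e1 + b *\<^sub>R e2" and ak: "a * (k - inner x x) = k / a"
    and cf: "cubic_form x e1 e2 (- a + a ^ 3 / k) 0 (- (a ^ 3 / k)) 0"
    and X': "(X has_derivative X') (at x within S)" "X' e2 = - (a ^ 4 / k) *\<^sub>R cJ e2 + (a ^ 3 * b / k) *\<^sub>R e1"
    using adapted_frame_k[OF x fr a] by metis
  obtain DN where DN: "((\<lambda>y. tproj S y v) has_derivative DN) (at x within S)"
    using tproj_const_derivative[OF x] by blast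
  \<comment> \<open>Local section by Gram-Schmidt: project the constant vector \<open>v\<close> to
    the tangent plane, remove the part along \<open>X\<close>, then rescale to the prescribed
    length. At \<open>x\<close> itself nothing changes.\<close>
  define M where "M y = tproj S y v - (inner (tproj S y v) (X y) / inner (X y) (X y)) *\<^sub>R X y" for y
  define \<phi> where "\<phi> y = (k - inner y y) / inner (M y) (M y)" for y
  define V where "V y = sqrt (\<phi> y) *\<^sub>R M y" for y
  have Mx: "M x = v" using v(2) tproj_tang_iff[OF x, of v] v(1) by (simp add: M_def)
  have vv: "inner v v > 0" using v(3) radius_less[OF x] by simp
  have phix: "\<phi> x = 1" using v(3) vv by (simp add: \<phi>_def Mx)
  have Vx: "V x = v" by (simp add: V_def phix Mx)
  have XX: "inner (X x) (X x) \<noteq> 0" using X_nonzero[OF x] by simp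
  have dX: "X differentiable (at x within S)" and dN: "(\<lambda>y. tproj S y v) differentiable (at x within S)"
    using X'(1) DN unfolding differentiable_def by blast+
  have dM: "M differentiable (at x within S)"
    unfolding M_def
    by (intro differentiable_diff differentiable_scaleR differentiable_divide differentiable_inner dX dN XX)
  have "\<phi> differentiable (at x within S)"
    unfolding \<phi>_def using vv
    by (intro differentiable_diff differentiable_divide differentiable_inner dM differentiable_const differentiable_ident) (simp add: Mx)
  then obtain \<phi>' where phi': "(\<phi> has_derivative \<phi>') (at x within S)" by (auto simp: differentiable_def)
  have "(\<lambda>y. sqrt (\<phi> y)) differentiable (at x within S)"
    using has_derivative_real_sqrt[OF _ phi'] phix unfolding differentiable_def by auto
  then have "V differentiable (at x within S)"
    unfolding V_def by (intro differentiable_scaleR dM)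
  then obtain V' where V': "(V has_derivative V') (at x within S)" by (auto simp: differentiable_def)
  have MT: "M y \<in> tang S y" "inner (M y) (X y) = 0" if "y \<in> S" for y
    unfolding M_def using X_nonzero[OF that]
    by (intro subspace_diff subspace_scale embedded_surface_tang(1)[OF surface that] X_tang tproj_in_tang that)
      (simp add: inner_diff_left)
  have VT: "tproj S y (V y) = V y" "inner (V y) (X y) = 0" if "y \<in> S" for y
    unfolding V_def using MT[OF that] tproj_tang_iff[OF that, of "M y"] by (simp_all add: linear_cmul[OF linear_tproj[OF that]])
  have VF: "(y, V y) \<in> frame_bundle" if y: "y \<in> S" and "M y \<noteq> 0" for y
  proof -
    have "inner (M y) (M y) > 0" using that by simp
    moreover have "\<phi> y > 0" using calculation radius_less[OF y] by (simp add: \<phi>_def)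
    ultimately have "inner (V y) (V y) = k - inner y y"
      using radius_less[OF y] by (simp add: V_def \<phi>_def flip: mult.assoc)
    then show ?thesis using VT[OF y] tproj_tang_iff[OF y] y by (simp add: frame_bundle_def)
  qed
  have "continuous (at x within S) M" using dM by (rule differentiable_imp_continuous_within)
  then have "eventually (\<lambda>y. M y \<noteq> 0) (at x within S)"
    unfolding continuous_within using vv by (intro tendsto_imp_eventually_ne) (auto simp: Mx)
  then obtain d where d: "d > 0" "\<And>y. y \<in> S \<Longrightarrow> y \<noteq> x \<Longrightarrow> dist y x < d \<Longrightarrow> M y \<noteq> 0"
    unfolding eventually_at by blast
  have Mnz: "M y \<noteq> 0" if "y \<in> S" "dist y x < d" for y
    using d(2)[OF that(1) _ that(2)] Mx vv by (cases "y = x") auto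
  obtain \<gamma> where gam: "\<gamma> 0 = x" "\<forall>t\<ge>0. \<gamma> t \<in> S" "(\<gamma> has_vector_derivative v) (at 0 within {0..})"
    using v(1) by (auto simp: tang_def)
  have "((\<lambda>y. (y, V y)) has_derivative (\<lambda>w. (w, V' w))) (at x within S)"
    by (intro has_derivative_Pair has_derivative_ident V')
  from tang_compose[OF this gam]
  have curve: "((\<lambda>t. (\<gamma> t, V (\<gamma> t))) has_vector_derivative (v, V' v)) (at 0 within {0..})" .
  have "continuous (at 0 within {0..}) \<gamma>" using gam(3) by (rule has_vector_derivative_continuous)
  then obtain \<delta> where \<delta>: "\<delta> > 0" "\<And>t. 0 \<le> t \<Longrightarrow> t < \<delta> \<Longrightarrow> dist (\<gamma> t) x < d"
    unfolding continuous_within_eps_delta gam(1) using d(1) by (force simp: dist_real_def)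
  have mem: "(v, V' v) \<in> tang frame_bundle (x, v)"
  proof (rule tangI_eventually[OF _ \<delta>(1) _ curve])
    show "(\<gamma> 0, V (\<gamma> 0)) = (x, v)" by (simp add: gam(1) Vx)
    show "(\<gamma> t, V (\<gamma> t)) \<in> frame_bundle" if "0 \<le> t" "t < \<delta>" for t
      using VF Mnz \<delta>(2)[OF that] gam(2) that by blast
  qed
  note l = has_derivative_linear[OF V'] has_derivative_linear[OF X'(1)]
  obtain D where D: "((\<lambda>y. tproj S y (V y)) has_derivative D) (at x within S)"
    "inner (D e2) (cJ e1) = 0 * inner v e1 + (- (a ^ 3 / k)) * inner v e2" "inner (D e2) (cJ e2) = (- (a ^ 3 / k)) * inner v e1 + 0 * inner v e2"
    using cf[unfolded cubic_form_def, rule_format, OF V'] unfolding Vx by blast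
  have "D e2 - V' e2 = 0"
    by (rule tang_derivative_const[OF has_derivative_diff[OF D(1) V'] _ frame_tang(2)[OF fr]]) (simp add: VT)
  then have VD: "V' v = \<mu> *\<^sub>R D e2" unfolding \<mu>(1) by (simp add: linear_cmul[OF l(1)])
  have "inner (V x) (X' v) + inner (V' v) (X x) = 0"
    by (rule tang_derivative_const[OF has_derivative_inner[OF V' X'(1)] _ v(1)]) (rule VT)
  then have c1: "inner (V' v) e1 = 0"
    using a(2) unfolding Vx a(1) \<mu>(1) by (simp add: linear_cmul[OF l(2)] X'(2) inner_add_right inner_diff_right i)
  have "inner (V x) (V' v) + inner (V' v) (V x) + (inner x v + inner v x) = 0"
  proof (rule tang_derivative_eventually_const[OF has_derivative_add[OF has_derivative_inner[OF V' V'] has_derivative_inner[OF has_derivative_ident has_derivative_ident]] _ _ x v(1)])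
    show "inner (V x) (V x) + inner x x = k" by (simp add: Vx v(3))
    have "inner (V y) (V y) + inner y y = k" if "y \<in> S" "dist y x < d" for y
      using VF[OF that(1) Mnz[OF that]] by (simp add: frame_bundle_def)
    then show "eventually (\<lambda>y. inner (V y) (V y) + inner y y = k) (at x within S)"
      unfolding eventually_at using d(1) by blast
  qed
  then have "inner (V' v) v = - inner x v" by (simp add: Vx inner_commute)
  then have "\<mu> * inner (V' v) e2 = \<mu> * (- inner x e2)" unfolding \<mu>(1) by simp
  then have c2: "inner (V' v) e2 = - inner x e2"
    using \<mu>(2) by (metis mult_left_cancel less_irrefl)
  have xi: "inner x e1 = 0" "inner x (cJ e1) = a" "inner x (cJ e2) = 0"
    by (subst b, simp add: inner_add_left i)+
  have ve: "inner v e1 = 0" "inner v e2 = \<mu>" by (simp_all add: \<mu>(1) i)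
  have c4: "inner (V' v) (cJ e2) = 0" unfolding VD by (simp add: D(3) ve)
  have "inner (V' v) (cJ e1) = - (a ^ 3 / k) * (k - inner x x)"
    unfolding VD \<mu>(3)[symmetric] by (simp add: D(2) ve power2_eq_square)
  also have "\<dots> = - (a ^ 2 / k) * (a * (k - inner x x))" by (simp add: power_numeral_reduce)
  also have "\<dots> = - a" unfolding ak using a(2) k_pos by (simp add: field_simps power2_eq_square)
  finally have c3: "inner (V' v) (cJ e1) = - a" .
  have "V' v = - x"
    by (rule unitary_eqI[OF up]) (simp_all add: c1 c2 c3 c4 xi)
  with mem show ?thesis by simp
qed

text \<open>The equation x'' = - x as a first order system for position and velocity, with the
  bundle as invariant compact set.\<close>

lemma great_circle:
  assumes F: "(x, v) \<in> frame_bundle" and s: "s \<ge> 0"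
  shows "(cos s *\<^sub>R x + sin s *\<^sub>R v, cos s *\<^sub>R v - sin s *\<^sub>R x) \<in> frame_bundle"
proof -
  define z where "z s = (cos s *\<^sub>R x + sin s *\<^sub>R v, cos s *\<^sub>R v - sin s *\<^sub>R x)" for s
  define Y where "Y y = (snd y, - fst y)" for y :: "C2 \<times> C2"
  have "z s \<in> frame_bundle"
  proof (rule tangent_linear_flow_invariant[OF compact_frame_bundle, where Y = Y])
    show "bounded_linear Y"
      unfolding Y_def by (intro bounded_linear_Pair bounded_linear_snd bounded_linear_minus bounded_linear_fst)
    show "Y y \<in> tang frame_bundle y" if "y \<in> frame_bundle" for y
      using frame_bundle_tang[of "fst y" "snd y"] that by (simp add: Y_def)
    show "(z has_vector_derivative Y (z t)) (at t)" for t
      unfolding z_def Y_def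
      by (auto intro!: derivative_eq_intros has_vector_derivative_Pair)
    show "z 0 \<in> frame_bundle" using F by (simp add: z_def)
  qed (rule s)
  then show ?thesis by (simp add: z_def)
qed

end

section \<open>The Clifford torus\<close>

context normalized_shrinker
begin

text \<open>Follow a great circle from \<open>x0\<close> for time \<open>s\<close>, then the orbit
  of \<open>W\<close> for time \<open>t\<close>. By \<open>W_formula\<close> the weights of the two
  rotations are the same at every point of the circle, so the orbits fit into one formula.\<close>

lemma product_parametrization:
  assumes x0: "x0 \<in> S" "tproj S x0 x0 = 0"
  obtains v0 \<alpha> \<beta> where "\<alpha> > 0" "\<beta> > 0" "\<alpha> + \<beta> = 1" "inner x0 x0 = 1 / \<alpha>" "inner v0 v0 = 1 / \<beta>"
    "inner x0 v0 = 0" "inner x0 (cJ v0) = 0"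
    "\<forall>s\<ge>0. \<forall>t\<ge>0. cos s *\<^sub>R rot (- \<alpha> * t) x0 + sin s *\<^sub>R rot (- \<beta> * t) v0 \<in> S"
proof -
  obtain e1 e2 a where fr: "frame S x0 e1 e2" and a: "X x0 = a *\<^sub>R e1" "a > 0" "a\<^sup>2 = inner (X x0) (X x0)"
    using adapted_frame_exists[OF x0(1) X_nonzero[OF x0(1)]] .
  have up: "unitary_pair e1 e2" using fr by (simp add: frame_def)
  note i = unitary_pair_inner[OF up]
  obtain b where b: "x0 = a *\<^sub>R cJ e1 + b *\<^sub>R e2" "tproj S x0 x0 = b *\<^sub>R e2"
    using adapted_frame_k[OF x0(1) fr a(1,2)] by metis
  have "b = 0" using b(2) x0(2) i(2) by auto
  then have x0e: "x0 = a *\<^sub>R cJ e1" using b(1) by simp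
  define R where "R = inner x0 x0"
  have Ra: "R = a\<^sup>2" unfolding R_def x0e by (simp add: i power2_eq_square)
  have RK: "R * (k - R) = k" using K[OF x0(1)] Ra a(3) by (simp add: R_def)
  have Rpos: "R > 0" and kR: "k - R > 0" using Ra a(2) radius_less[OF x0(1)] by (simp_all add: R_def)
  define \<mu> where "\<mu> = sqrt (k - R)"
  have \<mu>: "\<mu> * \<mu> = k - R" using kR by (simp add: \<mu>_def)
  define v0 where "v0 = \<mu> *\<^sub>R e2"
  have v0v0: "inner v0 v0 = k - R" by (simp add: v0_def i \<mu>)
  have F: "(x0, v0) \<in> frame_bundle"
    using x0(1) subspace_scale[OF embedded_surface_tang(1)[OF surface x0(1)] frame_tang(2)[OF fr]] v0v0
    by (simp add: frame_bundle_def v0_def a(1) i R_def)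
  have xv: "inner x0 v0 = 0" "inner x0 (cJ v0) = 0" by (simp_all add: x0e v0_def i)
  \<comment> \<open>\<open>RK\<close> says precisely that 1/R + 1/(k - R) = 1, which gives the sum 1
    and the product \<open>1 / k\<close> required of the weights.\<close>
  define \<alpha> where "\<alpha> = 1 / R"
  define \<beta> where "\<beta> = 1 / (k - R)"
  have al: "\<alpha> = (k - R) / k" and be: "\<beta> = R / k"
    using RK Rpos kR k_pos by (auto simp: \<alpha>_def \<beta>_def field_simps)
  have ab: "\<alpha> + \<beta> = 1" unfolding al be using k_pos by (simp add: field_simps)
  have abk: "\<alpha> * \<beta> = 1 / k" using RK by (simp add: \<alpha>_def \<beta>_def)
  have mem: "cos s *\<^sub>R rot (- \<alpha> * t) x0 + sin s *\<^sub>R rot (- \<beta> * t) v0 \<in> S" if s: "s \<ge> 0" and t: "t \<ge> 0" for s t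
  proof -
    define x where "x = cos s *\<^sub>R x0 + sin s *\<^sub>R v0"
    define v where "v = cos s *\<^sub>R v0 - sin s *\<^sub>R x0"
    have F': "(x, v) \<in> frame_bundle" using great_circle[OF F s] by (simp add: x_def v_def)
    have xx: "inner x x = R * (cos s)\<^sup>2 + (k - R) * (sin s)\<^sup>2"
      by (simp add: x_def inner_add_left inner_add_right xv inner_commute[of v0 x0] v0v0 R_def power2_eq_square)
    have xv': "inner x v = cos s * sin s * (k - 2 * R)"
      by (simp add: x_def v_def inner_add_left inner_diff_right xv inner_commute[of v0 x0] v0v0 algebra_simps flip: R_def)
    have cs: "(cos s)\<^sup>2 = 1 - (sin s)\<^sup>2" by (rule cos_squared_eq)
    have 1: "(k - inner x x) * cos s + inner x v * sin s = (k - R) * cos s"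
      unfolding xx xv' using cs by algebra
    have 2: "(k - inner x x) * sin s - inner x v * cos s = R * sin s"
      unfolding xx xv' using cs by algebra
    have gen: "A *\<^sub>R x - B *\<^sub>R v = (A * cos s + B * sin s) *\<^sub>R x0 + (A * sin s - B * cos s) *\<^sub>R v0" for A B
      by (simp add: x_def v_def algebra_simps)
    have "(k - inner x x) / k * cos s + inner x v / k * sin s = \<alpha> * cos s"
      "(k - inner x x) / k * sin s - inner x v / k * cos s = \<beta> * sin s"
      unfolding al be using 1 2 k_pos by (simp_all add: field_simps)
    then have "((k - inner x x) / k) *\<^sub>R x - (inner x v / k) *\<^sub>R v = \<alpha> *\<^sub>R (cos s *\<^sub>R x0) + \<beta> *\<^sub>R (sin s *\<^sub>R v0)"
      unfolding gen by simp
    then have "W x = - cJ (\<alpha> *\<^sub>R (cos s *\<^sub>R x0) + \<beta> *\<^sub>R (sin s *\<^sub>R v0))"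
      using W_formula[OF F'] by simp
    moreover have "x \<in> S" using F' by (simp add: frame_bundle_def)
    ultimately have "rot (- \<alpha> * t) (cos s *\<^sub>R x0) + rot (- \<beta> * t) (sin s *\<^sub>R v0) \<in> S"
      using rotation_orbit[of x "cos s *\<^sub>R x0" "sin s *\<^sub>R v0" \<alpha> \<beta> t] ab abk t by (simp add: x_def)
    then show ?thesis by (simp add: rot_def algebra_simps)
  qed
  have mem': "\<forall>s\<ge>0. \<forall>t\<ge>0. cos s *\<^sub>R rot (- \<alpha> * t) x0 + sin s *\<^sub>R rot (- \<beta> * t) v0 \<in> S"
    by (intro allI impI mem)
  show ?thesis
    by (rule that[OF _ _ ab _ _ xv mem'])
      (use Rpos kR in \<open>simp_all add: \<alpha>_def \<beta>_def v0v0 flip: R_def\<close>)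
qed

text \<open>Embeddedness enters here: the sheets of the parametrization meeting in \<open>v\<^sub>0\<close> have the tangent
  directions \<open>x\<^sub>0\<close> and \<open>exp(-i\<pi>\<alpha>/\<beta>) x\<^sub>0\<close>, which must lie in one Lagrangian plane.\<close>

lemma sheets_agree:
  assumes v0: "v0 \<in> S" and x0: "inner x0 x0 > 0"
    and mem: "\<And>s t. s \<ge> 0 \<Longrightarrow> t \<ge> 0 \<Longrightarrow> cos s *\<^sub>R rot (- \<beta> * t) v0 + sin s *\<^sub>R rot (- \<alpha> * t) x0 \<in> S"
    and ab: "\<beta> > 0"
  shows "\<alpha> / \<beta> \<in> \<int>"
proof -
  \<comment> \<open>At \<open>t = pi / \<beta>\<close> the vector \<open>v0\<close> has made a half
    turn, and \<open>s = pi\<close> undoes the sign: the sheet meets \<open>v0\<close> again, with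
    \<open>x0\<close> turned by \<open>\<theta>\<close>.\<close>
  define \<theta> where "\<theta> = - \<alpha> * (pi / \<beta>)"
  have "((\<lambda>s. cos s *\<^sub>R rot (- \<beta> * 0) v0 + sin s *\<^sub>R rot (- \<alpha> * 0) x0) has_vector_derivative x0) (at 0 within {0..})"
    by (auto intro!: derivative_eq_intros simp: rot_def)
  then have 1: "x0 \<in> tang S v0"
    by (rule tangI_eventually[of _ _ 1, rotated 3]) (use mem[of _ 0] in \<open>auto simp: rot_def\<close>)
  have r: "rot (- \<beta> * (pi / \<beta>)) v0 = - v0" using ab by (simp add: rot_def)
  have "((\<lambda>s. cos (pi + s) *\<^sub>R rot (- \<beta> * (pi / \<beta>)) v0 + sin (pi + s) *\<^sub>R rot \<theta> x0) has_vector_derivative - rot \<theta> x0) (at 0 within {0..})"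
    by (auto intro!: derivative_eq_intros)
  then have 2: "- rot \<theta> x0 \<in> tang S v0"
  proof (rule tangI_eventually[of _ _ 1, rotated 3])
    show "cos (pi + s) *\<^sub>R rot (- \<beta> * (pi / \<beta>)) v0 + sin (pi + s) *\<^sub>R rot \<theta> x0 \<in> S" if "0 \<le> s" "s < 1" for s
      unfolding \<theta>_def by (rule mem) (use that ab in auto)
  qed (simp_all only: r, simp_all)
  have "inner x0 (cJ (- rot \<theta> x0)) = 0"
    by (rule lagrangian_tang[OF surface lagrangian v0 1 2])
  then have "sin \<theta> = 0" using x0 by (simp add: rot_def inner_add_right inner_diff_right)
  then have "sin ((\<alpha> / \<beta>) * pi) = 0" by (simp add: \<theta>_def)
  then show ?thesis by (simp only: sin_times_pi_eq_0)
qed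

lemma torus_subset:
  assumes x0: "x0 \<in> S" "tproj S x0 x0 = 0"
  obtains v0 where "inner x0 x0 = 2" "inner v0 v0 = 2" "inner x0 v0 = 0" "inner x0 (cJ v0) = 0"
    "\<And>s t. cos s *\<^sub>R rot t x0 + sin s *\<^sub>R rot t v0 \<in> S"
proof -
  obtain v0 \<alpha> \<beta> where ab: "\<alpha> > 0" "\<beta> > 0" "\<alpha> + \<beta> = 1" and n: "inner x0 x0 = 1 / \<alpha>" "inner v0 v0 = 1 / \<beta>"
    and o: "inner x0 v0 = 0" "inner x0 (cJ v0) = 0"
    and mem': "\<forall>s\<ge>0. \<forall>t\<ge>0. cos s *\<^sub>R rot (- \<alpha> * t) x0 + sin s *\<^sub>R rot (- \<beta> * t) v0 \<in> S"
    using product_parametrization[OF x0] by metis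
  have mem: "cos s *\<^sub>R rot (- \<alpha> * t) x0 + sin s *\<^sub>R rot (- \<beta> * t) v0 \<in> S" if "s \<ge> 0" "t \<ge> 0" for s t
    using mem' that by blast
  have per: "cos (2 * pi * real n) = 1" "sin (2 * pi * real n) = 0" for n
    using cos_2npi[of n] sin_2npi[of n] by (simp_all add: ac_simps)
  have v0: "v0 \<in> S" using mem[of "pi / 2" 0] by (simp add: rot_def)
  \<comment> \<open>Replacing \<open>s\<close> by \<open>pi / 2 - s\<close> exchanges the roles of
    \<open>x0\<close> and \<open>v0\<close>; full turns are added to keep the parameter
    nonnegative.\<close>
  have swap: "cos s *\<^sub>R rot (- \<beta> * t) v0 + sin s *\<^sub>R rot (- \<alpha> * t) x0 \<in> S" if "s \<ge> 0" "t \<ge> 0" for s t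
  proof -
    obtain n :: nat where "s \<le> 2 * pi * real n"
      using real_arch_simple[of "s / (2 * pi)"] by (auto simp: field_simps)
    then have "pi / 2 - s + 2 * pi * real n \<ge> 0" using pi_gt_zero by linarith
    from mem[OF this that(2)]
    show ?thesis
      by (simp add: cos_add sin_add cos_diff sin_diff per add.commute)
  qed
  have "inner x0 x0 > 0" "inner v0 v0 > 0" using n ab by simp_all
  then have "\<alpha> / \<beta> \<in> \<int>" "\<beta> / \<alpha> \<in> \<int>"
    using sheets_agree[OF v0 _ swap ab(2)] sheets_agree[OF x0(1) _ mem ab(1)] by auto
  moreover have "1 \<le> r" if "r \<in> \<int>" "r > 0" for r :: real
    using that by (auto elim!: Ints_cases)
  ultimately have "1 \<le> \<alpha> / \<beta>" "1 \<le> \<beta> / \<alpha>" using ab by simp_all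
  then have "\<alpha> = \<beta>" using ab by (simp add: field_simps)
  then have half: "\<alpha> = 1 / 2" "\<beta> = 1 / 2" using ab by simp_all
  have all: "cos s *\<^sub>R rot t x0 + sin s *\<^sub>R rot t v0 \<in> S" for s t
  proof -
    obtain m :: nat where m: "- s \<le> 2 * pi * real m"
      using real_arch_simple[of "- s / (2 * pi)"] by (auto simp: field_simps)
    obtain n :: nat where n: "t \<le> 2 * pi * real n"
      using real_arch_simple[of "t / (2 * pi)"] by (auto simp: field_simps)
    \<comment> \<open>Both weights being one half, the parameter
      \<open>2 * (2 * pi * real n - t)\<close> rotates by \<open>t\<close> up to full turns;
      \<open>m\<close> and \<open>n\<close> make the two parameters nonnegative.\<close>
    have "s + 2 * pi * real m \<ge> 0" "2 * (2 * pi * real n - t) \<ge> 0" using m n by simp_all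
    moreover have "rot (- (1 / 2) * (2 * (2 * pi * real n - t))) w = rot t w" for w
    proof -
      have "- (1 / 2) * (2 * (2 * pi * real n - t)) = t - 2 * pi * real n" by (simp add: field_simps)
      then show ?thesis by (simp only: rot_def cos_diff sin_diff per) simp
    qed
    ultimately show ?thesis
      using mem[of "s + 2 * pi * real m" "2 * (2 * pi * real n - t)"]
      by (simp only: half cos_add sin_add per) simp
  qed
  show ?thesis using that[OF _ _ o all] n half by simp
qed

end

text \<open>Read in a chart, \<open>E\<close> is a locally injective continuous map between planar
  domains, so invariance of domain applies. Injectivity is only local because the map used later is
  doubly periodic.\<close>

lemma locally_injective_range_open:
  fixes E :: "R2 \<Rightarrow> C2"
  assumes S: "embedded_surface S" and E: "continuous_on UNIV E" "range E \<subseteq> S"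
    and inj: "\<And>w. \<exists>e>0. inj_on E (ball w e)"
  shows "openin (top_of_set S) (range E)"
proof (subst openin_subopen, intro ballI)
  fix y assume "y \<in> range E"
  then obtain w where w: "y = E w" by blast
  then have "y \<in> S" using E(2) by blast
  then obtain U f where c: "chart S U f" "y \<in> f ` U" using S unfolding embedded_surface_def by blast
  obtain g where g: "homeomorphism U (f ` U) f g" using c by (auto simp: chart_def)
  have U: "open U" and oU: "openin (top_of_set S) (f ` U)" using c by (auto simp: chart_def smooth_on_def)
  obtain O' where O': "open O'" "f ` U = S \<inter> O'" using oU by (auto simp: openin_open)
  obtain e1 where e1: "e1 > 0" "inj_on E (ball w e1)" using inj by blast
  have "open (E -` O')" using E(1) O'(1) by (simp add: continuous_on_open_vimage)
  moreover have "y \<in> O'" using c(2) unfolding O'(2) by simp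
  then have "w \<in> E -` O'" by (simp add: w)
  ultimately obtain e2 where e2: "e2 > 0" "ball w e2 \<subseteq> E -` O'" by (rule openE)
  define B where "B = ball w (min e1 e2)"
  have EB: "E ` B \<subseteq> f ` U" using e2 E(2) O'(2) by (auto simp: B_def)
  have injB: "inj_on E B" using e1(2) by (rule inj_on_subset) (auto simp: B_def)
  have gc: "continuous_on (f ` U) g" and gi: "inj_on g (f ` U)" and fg: "\<And>z. z \<in> f ` U \<Longrightarrow> f (g z) = z" and gU: "g ` f ` U = U"
    using g by (auto simp: homeomorphism_def intro: inj_on_inverseI)
  have "open ((\<lambda>v. g (E v)) ` B)"
  proof (rule invariance_of_domain)
    show "continuous_on B (\<lambda>v. g (E v))"
      by (rule continuous_on_compose2[OF gc continuous_on_subset[OF E(1)] EB]) simp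
    show "inj_on (\<lambda>v. g (E v)) B"
      using comp_inj_on[OF injB inj_on_subset[OF gi EB]] by (simp add: o_def)
  qed (simp add: B_def)
  moreover have "(\<lambda>v. g (E v)) ` B \<subseteq> U" using EB gU by blast
  ultimately have "openin (top_of_set U) ((\<lambda>v. g (E v)) ` B)" using U by (simp add: openin_open_eq)
  then have "openin (top_of_set (f ` U)) (f ` (\<lambda>v. g (E v)) ` B)" by (rule homeomorphism_imp_open_map[OF g])
  moreover have "f ` (\<lambda>v. g (E v)) ` B = E ` B"
  proof -
    have "f (g (E v)) = E v" if "v \<in> B" for v using that EB by (intro fg) blast
    then show ?thesis by (simp add: image_image)
  qed
  ultimately have "openin (top_of_set S) (E ` B)" using openin_trans oU by metis
  moreover have "y \<in> E ` B" using w e1(1) e2(1) by (auto simp: B_def)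
  ultimately show "\<exists>T. openin (top_of_set S) T \<and> y \<in> T \<and> T \<subseteq> range E" by blast
qed

section \<open>Unitary coordinates on the torus\<close>

definition cscale :: "complex \<Rightarrow> C2 \<Rightarrow> C2" where
  "cscale z v = Re z *\<^sub>R v + Im z *\<^sub>R cJ v"

text \<open>The complex linear map with columns \<open>u\<close> and \<open>v\<close>; it is unitary
  when \<open>unitary_pair u v\<close> holds.\<close>

definition cframe :: "C2 \<Rightarrow> C2 \<Rightarrow> C2 \<Rightarrow> C2" where
  "cframe u v p = cscale (fst p) u + cscale (snd p) v"

lemma bounded_linear_cframe: "bounded_linear (cframe u v)"
  unfolding cframe_def cscale_def
  by (intro bounded_linear_add bounded_linear_scaleR_const bounded_linear_compose[OF bounded_linear_Re]
      bounded_linear_compose[OF bounded_linear_Im] bounded_linear_fst bounded_linear_snd)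

lemma norm_cframe:
  assumes "unitary_pair u v" shows "norm (cframe u v p) = norm p"
proof -
  note i = unitary_pair_inner[OF assms]
  have "inner (cframe u v p) (cframe u v p) = inner p p"
    by (cases p) (simp add: cframe_def cscale_def inner_add_left inner_add_right i inner_complex_def)
  then show ?thesis by (simp add: norm_eq_sqrt_inner)
qed

lemma cframe_cis: "cframe u v (cis a, cis b) = rot a u + rot b v"
  by (simp add: cframe_def cscale_def rot_def)

lemma clifford_torus_cis: "clifford_torus = range (\<lambda>w. (cis (fst w), cis (snd w)))"
proof -
  have "\<exists>a. z = cis a" if "cmod z = 1" for z
    using rcis_cmod_Arg[of z] that by (metis mult_1 of_real_1 rcis_def)
  then show ?thesis by (auto simp: clifford_torus_def image_iff)
qed

lemma cis_eq_close:
  assumes "cis a = cis b" "\<bar>a - b\<bar> < 2"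
  shows "a = b"
proof -
  have "sin a = sin b" "cos a = cos b" using assms(1) by (simp_all add: complex_eq_iff)
  then have "cos (a - b) = 1" by (simp add: cos_diff flip: power2_eq_square)
  then obtain n :: int where "a - b = of_int n * (2 * pi)" by (auto simp: cos_one_2pi_int mult.assoc)
  moreover have "\<bar>a - b\<bar> < 2 * pi" using assms(2) pi_gt3 by linarith
  ultimately have "\<bar>real_of_int n\<bar> * (2 * pi) < 1 * (2 * pi)" by (simp add: abs_mult)
  then have "\<bar>real_of_int n\<bar> < 1" by (rule mult_right_less_imp_less) simp
  then have "n = 0" by linarith
  then show ?thesis using \<open>a - b = of_int n * (2 * pi)\<close> by simp
qed

theorem theorem1p6:
  fixes S :: "C2 set"
  assumes "embedded_surface S" and "compact S" and "connected S" and "S \<noteq> {}"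
    and "self_shrinker S"
    and "lagrangian S"
    and "hamiltonian_stationary S"
  shows "\<exists>L. linear L \<and> (\<forall>x. norm (L x) = norm x) \<and> S = L ` clifford_torus"
proof -
  interpret compact_shrinker S by unfold_locales fact+
  obtain k x0 where k: "k > 0" "\<And>y. y \<in> S \<Longrightarrow> inner (X y) (X y) * (k - inner y y) = k"
    and x0: "x0 \<in> S" "tproj S x0 x0 = 0"
    using first_integral by blast
  interpret normalized_shrinker S k by unfold_locales (use k in auto)
  obtain v0 where n: "inner x0 x0 = 2" "inner v0 v0 = 2" and o: "inner x0 v0 = 0" "inner x0 (cJ v0) = 0"
    and sub: "\<And>s t. cos s *\<^sub>R rot t x0 + sin s *\<^sub>R rot t v0 \<in> S"
    using torus_subset[OF x0] by metis
  \<comment> \<open>Writing cosine and sine through exp(i s) and exp(-i s), the family becomes exp(i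
    (t + s)) u + exp(i (t - s)) v with these coefficients; the squared lengths 2 of
    \<open>x0\<close> and \<open>v0\<close> make \<open>u\<close> and \<open>v\<close> unit
    vectors.\<close>
  define u where "u = (1 / 2) *\<^sub>R (x0 - cJ v0)"
  define v where "v = (1 / 2) *\<^sub>R (x0 + cJ v0)"
  have "unitary_pair u v"
    using n o inner_commute[of x0 "cJ v0"] inner_commute[of v0 x0]
    by (simp add: unitary_pair_def u_def v_def inner_diff_left inner_diff_right inner_add_left inner_add_right)
  note L = bounded_linear_cframe[of u v] norm_cframe[OF this]
  define E where "E w = cframe u v (cis (fst w), cis (snd w))" for w :: R2
  have range: "range E = cframe u v ` clifford_torus"
    unfolding clifford_torus_cis E_def by (simp add: image_image)
  have "E w \<in> S" for w
  proof -
    define s t where "s = (fst w - snd w) / 2" and "t = (fst w + snd w) / 2"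
    have w: "fst w = t + s" "snd w = t - s" by (simp_all add: s_def t_def field_simps)
    have "rot (t + s) u + rot (t - s) v =
       ((cos (t + s) + cos (t - s)) / 2) *\<^sub>R x0 + ((cos (t - s) - cos (t + s)) / 2) *\<^sub>R cJ v0
       + ((sin (t + s) + sin (t - s)) / 2) *\<^sub>R cJ x0 + ((sin (t + s) - sin (t - s)) / 2) *\<^sub>R v0"
      by (simp add: rot_def u_def v_def algebra_simps add_divide_distrib diff_divide_distrib del: cos_add sin_add)
    also have "\<dots> = cos s *\<^sub>R rot t x0 + sin s *\<^sub>R rot t v0"
      by (simp add: rot_def cos_add sin_add cos_diff sin_diff algebra_simps)
    finally show ?thesis using sub[of s t] by (simp add: E_def cframe_cis w)
  qed
  then have ES: "range E \<subseteq> S" by blast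
  have cE: "continuous_on UNIV E"
    unfolding E_def
    by (intro bounded_linear.continuous_on[OF L(1)] continuous_on_Pair continuous_on_cis continuous_on_fst continuous_on_snd continuous_on_id)
  have "\<exists>e>0. inj_on E (ball w e)" for w
  \<comment> \<open>Points of a ball of radius 1 have coordinates less than 2 apart, which is below
    the period of \<open>cis\<close>.\<close>
  proof (intro exI[of _ 1] conjI inj_onI)
    fix p q assume pq: "p \<in> ball w 1" "q \<in> ball w 1" "E p = E q"
    have "norm (cframe u v ((cis (fst p), cis (snd p)) - (cis (fst q), cis (snd q)))) = 0"
      unfolding linear_diff[OF bounded_linear.linear[OF L(1)]] using pq(3) by (simp add: E_def)
    then have e: "cis (fst p) = cis (fst q)" "cis (snd p) = cis (snd q)" by (simp_all add: L(2) zero_prod_def)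
    have "dist p q < 2" using pq dist_triangle_less_add[of p w 1 q 1] by (simp add: dist_commute)
    then have "\<bar>fst p - fst q\<bar> < 2" "\<bar>snd p - snd q\<bar> < 2"
      using dist_fst_le[of p q] dist_snd_le[of p q] by (simp_all add: dist_real_def)
    then show "p = q" using cis_eq_close e by (simp add: prod_eq_iff)
  qed simp
  then have "openin (top_of_set S) (range E)" by (rule locally_injective_range_open[OF surface cE ES])
  moreover have "closedin (top_of_set S) (range E)"
  proof -
    have "compact clifford_torus"
    proof -
      have "clifford_torus = sphere 0 1 \<times> sphere 0 1" by (auto simp: clifford_torus_def)
      then show ?thesis by (metis compact_Times compact_sphere)
    qed
    then have "compact (range E)"
      unfolding range by (intro compact_continuous_image bounded_linear.continuous_on[OF L(1)] continuous_on_id)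
    then show ?thesis using ES by (intro closed_subset compact_imp_closed)
  qed
  ultimately have "range E = S" using conn[unfolded connected_clopen, rule_format, of "range E"] by blast
  then show ?thesis
    using L(2) bounded_linear.linear[OF L(1)] range by (intro exI[of _ "cframe u v"]) simp
qed

end
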